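(* Let $\beta$ be a Pisot or Salem number with $\beta>\sqrt{\varphi}=1.272019649\ldots$, where $\varphi=(1+\sqrt5)/2$. Then the numbers \[ 1,\quad \sum_{n\geqslant 1}\frac{t(n)}{\beta^n},\quad \sum_{n\geqslant 1}\frac{t(n^2)}{\beta^n},\quad \ldots,\quad \sum_{n\geqslant 1}\frac{t(n^k)}{\beta^n},\quad \ldots \] are linearly independent over $\mathbb{Q}(\beta)$, i.e. every non-empty finite subset of this set is linearly independent over $\mathbb{Q}(\beta)$. In particular, the result holds for all Pisot numbers $\beta$.
   Context: For an integer $n\geqslant 0$, let $s_2(n)$ be the number of ones in the binary expansion of $n$; the Thue--Morse sequence is $t(n)=1$ if $s_2(n)$ is odd and $t(n)=0$ if $s_2(n)$ is even. A Pisot number is a real algebraic integer $\beta>1$ all of whose Galois conjugates other than $\beta$ have absolute value $<1$. A Salem number is a real algebraic integer $\beta>1$ all of whose Galois conjugates other than $\beta$ have absolute value $\leqslant 1$, with at least one of absolute value exactly $1$. *)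

theory Defs
  imports Complex_Main "HOL-Computational_Algebra.Polynomial"
begin

definition s2 :: "nat \<Rightarrow> nat" where
  "s2 n = card {i. bit n i}"

definition thue_morse :: "nat \<Rightarrow> nat" where
  "thue_morse n = (if odd (s2 n) then 1 else 0)"

definition is_minimal_poly :: "rat poly \<Rightarrow> 'a :: field_char_0 \<Rightarrow> bool" where
  "is_minimal_poly p x \<longleftrightarrow> lead_coeff p = 1 \<and> irreducible p \<and> poly (map_poly of_rat p) x = 0"

text \<open>All complex roots of the minimal polynomial over the rationals, the number itself included.\<close>

definition galois_conjugates :: "real \<Rightarrow> complex set" where
  "galois_conjugates x = {z. \<exists>p. is_minimal_poly p x \<and> poly (map_poly of_rat p) z = 0}"

definition pisot :: "real \<Rightarrow> bool" where
  "pisot \<beta> \<longleftrightarrow> algebraic_int \<beta> \<and> \<beta> > 1 \<and>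
     (\<forall>z \<in> galois_conjugates \<beta> - {of_real \<beta>}. norm z < 1)"

definition salem :: "real \<Rightarrow> bool" where
  "salem \<beta> \<longleftrightarrow> algebraic_int \<beta> \<and> \<beta> > 1 \<and>
     (\<forall>z \<in> galois_conjugates \<beta> - {of_real \<beta>}. norm z \<le> 1) \<and>
     (\<exists>z \<in> galois_conjugates \<beta> - {of_real \<beta>}. norm z = 1)"

definition is_subfield :: "'a :: field set \<Rightarrow> bool" where
  "is_subfield K \<longleftrightarrow> 0 \<in> K \<and> 1 \<in> K \<and> (\<forall>x\<in>K. \<forall>y\<in>K. x + y \<in> K \<and> x * y \<in> K) \<and>
     (\<forall>x\<in>K. - x \<in> K \<and> inverse x \<in> K)"

text \<open>The field \<open>\<rat>(x)\<close>; a subfield of the reals automatically contains the rationals.\<close>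

definition rat_adjoin :: "real \<Rightarrow> real set" where
  "rat_adjoin x = is_subfield hull {x}"

text \<open>
  Linear independence of a family over a set \<open>K\<close> of scalars (intended: a subfield).
  It is stated for families, not for their ranges, so a family with repeated members is dependent.
\<close>

definition lin_indep_family :: "'a :: field set \<Rightarrow> ('i \<Rightarrow> 'a) \<Rightarrow> bool" where
  "lin_indep_family K v \<longleftrightarrow>
     (\<forall>I c. finite I \<and> (\<forall>i\<in>I. c i \<in> K) \<and> (\<Sum>i\<in>I. c i * v i) = 0 \<longrightarrow> (\<forall>i\<in>I. c i = 0))"

definition thue_morse_value :: "real \<Rightarrow> nat \<Rightarrow> real" where
  "thue_morse_value \<beta> k = (\<Sum>n. real (thue_morse (Suc n ^ k)) / \<beta> ^ Suc n)"

text \<open>Index \<open>0\<close> carries the number \<open>1\<close>, not the series with \<open>k = 0\<close>.\<close>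

definition thue_morse_family :: "real \<Rightarrow> nat \<Rightarrow> real" where
  "thue_morse_family \<beta> k = (if k = 0 then 1 else thue_morse_value \<beta> k)"

end

theory Submission
  imports Defs "Jordan_Normal_Form.Char_Poly" "HOL-Computational_Algebra.Field_as_Ring"
begin

text \<open>
  Suppose \<open>a\<^sub>0 + (\<Sum>n. T n / \<beta> ^ n) = 0\<close>, where \<open>T n\<close> is the sum of \<open>a\<^sub>k * t (n ^ k)\<close> over
  \<open>1 \<le> k \<le> K\<close>, the \<open>a\<^sub>k\<close> lie in \<open>\<int>[\<beta>]\<close>, and \<open>a\<^sub>K \<noteq> 0\<close>. The tails of the series, scaled by
  \<open>\<beta> ^ N\<close>, are then elements of \<open>\<int>[\<beta>]\<close> whose other conjugates are \<open>O(N)\<close>. As norms are integers,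
  the difference of the tails at \<open>N\<close> and \<open>N'\<close> is zero or at least a negative power of \<open>N + N'\<close>.

  On the other hand, for every \<open>b\<close> there are \<open>N\<close> and \<open>N'\<close> below \<open>2 ^ O(b)\<close> whose tails differ by
  a nonzero \<open>O(\<beta> ^ (- 2 ^ b))\<close>, a contradiction for large \<open>b\<close>. If \<open>K = 1\<close>, take \<open>2 ^ b\<close> and
  \<open>2 ^ (b + 1)\<close>; the main term is the product of the numbers \<open>1 - \<beta> ^ (- 2 ^ i)\<close> with \<open>i < b\<close>.
  If \<open>K \<ge> 2\<close>, take \<open>N = w * Y ^ K + 2 ^ r * Y ^ (K - 1)\<close> for a large power \<open>Y\<close> of \<open>2\<close>. In base
  \<open>Y\<close> the terms of the expansion of \<open>(N + j) ^ k\<close> occupy distinct digits, except that for \<open>k = K\<close>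
  the terms \<open>K * w ^ (K - 1) * j\<close> and \<open>2 ^ (r * K)\<close> share one. So the parity of the digit sum
  depends on \<open>r\<close> only through the carries in \<open>K * w ^ (K - 1) * j + 2 ^ (r * K)\<close>, and for a suitable
  \<open>w\<close> two values of \<open>r\<close> give parities that differ at \<open>j = 2 ^ b\<close> and agree at every other
  \<open>j \<le> 2 * 2 ^ b - 2\<close>.
\<close>

subsection \<open>Binary digit sums\<close>

lemma finite_bits: "finite {i. bit (n::nat) i}"
proof (rule finite_subset)
  show "{i. bit n i} \<subseteq> {..<n}"
    by (auto simp: bit_iff_odd) (metis div_less even_zero less_exp linorder_not_less order_less_le_trans)
qed simp

lemma s2_0 [simp]: "s2 0 = 0"
  by (simp add: s2_def)

lemma s2_double [simp]: "s2 (2 * n) = s2 n"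
proof -
  have "{i. bit (2 * n) i} = Suc ` {i. bit n i}"
    by (auto simp: bit_double_iff image_iff gr0_conv_Suc)
  then show ?thesis by (simp add: s2_def card_image)
qed

lemma s2_Suc_double [simp]: "s2 (Suc (2 * n)) = Suc (s2 n)"
proof -
  have "{i. bit (Suc (2 * n)) i} = insert 0 (Suc ` {i. bit n i})"
  proof (rule Set.set_eqI)
    fix i show "i \<in> {i. bit (Suc (2 * n)) i} \<longleftrightarrow> i \<in> insert 0 (Suc ` {i. bit n i})"
      by (cases i) (auto simp: bit_0 bit_Suc)
  qed
  then show ?thesis by (simp add: s2_def card_image finite_bits)
qed

lemma s2_1 [simp]: "s2 (Suc 0) = 1"
  using s2_Suc_double[of 0] by simp

lemma s2_mult_pow2 [simp]: "s2 (2 ^ m * n) = s2 n"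
  by (induction m) (simp_all add: mult.assoc)

lemma s2_pow2 [simp]: "s2 (2 ^ m) = 1"
  using s2_mult_pow2[of m 1] by simp

text \<open>There is no carry: \<open>a\<close> occupies the lowest \<open>m\<close> bits and
  \<open>b\<close> the bits above. The induction removes the last bit of \<open>a\<close>.\<close>

lemma s2_add_pow2_mult: "a < 2 ^ m \<Longrightarrow> s2 (a + 2 ^ m * b) = s2 a + s2 b"
proof (induction m arbitrary: a)
  case (Suc m)
  obtain c r where a: "a = 2 * c + r" "r < 2"
    by (metis mod_less_divisor mult_div_mod_eq pos2)
  with Suc.prems have "c < 2 ^ m" by auto
  have "s2 (a + 2 ^ Suc m * b) = s2 (2 * (c + 2 ^ m * b) + r)"
    by (simp add: a algebra_simps)
  also have "\<dots> = s2 (c + 2 ^ m * b) + r"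
    using a(2) by (auto simp: less_2_cases_iff simp del: distrib_left_numeral)
  also have "\<dots> = s2 (2 * c + r) + s2 b"
    using a(2) Suc.IH[OF \<open>c < 2 ^ m\<close>] by (auto simp: less_2_cases_iff)
  finally show ?case by (simp add: a)
qed simp

lemma s2_sum_blocks:
  assumes "\<And>i. i < n \<Longrightarrow> a i < 2 ^ g"
  shows "s2 (\<Sum>i<n. a i * 2 ^ (g * i)) = (\<Sum>i<n. s2 (a i))"
  using assms
proof (induction n arbitrary: a)
  case (Suc n)
  have "(\<Sum>i<Suc n. a i * 2 ^ (g * i)) = a 0 + 2 ^ g * (\<Sum>i<n. a (Suc i) * 2 ^ (g * i))"
    by (subst sum.lessThan_Suc_shift) (simp add: sum_distrib_left power_add algebra_simps)
  also have "s2 \<dots> = s2 (a 0) + (\<Sum>i<n. s2 (a (Suc i)))"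
    using Suc.IH[of "\<lambda>i. a (Suc i)"] Suc.prems by (subst s2_add_pow2_mult) auto
  also have "\<dots> = (\<Sum>i<Suc n. s2 (a i))"
    by (simp only: sum.lessThan_Suc_shift)
  finally show ?case .
qed simp

text \<open>Distinct exponents put the coefficients into disjoint blocks of \<open>g\<close> bits.
  Exponents that do not occur are filled with zero blocks, which reduces the claim to consecutive
  blocks.\<close>

lemma s2_sum_inj:
  assumes "finite X" "inj_on e X" "\<And>x. x \<in> X \<Longrightarrow> a x < 2 ^ g"
  shows "s2 (\<Sum>x\<in>X. a x * 2 ^ (g * e x)) = (\<Sum>x\<in>X. s2 (a x))"
proof -
  define M where "M = Suc (Max (e ` X))"
  have sub: "e ` X \<subseteq> {..<M}"
    using assms(1) by (auto simp: M_def less_Suc_eq_le)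
  define b where "b i = (if i \<in> e ` X then a (inv_into X e i) else 0)" for i
  have be: "b (e x) = a x" if "x \<in> X" for x
    using that assms(2) by (simp add: b_def)
  have "(\<Sum>x\<in>X. a x * 2 ^ (g * e x)) = (\<Sum>i\<in>e ` X. b i * 2 ^ (g * i))"
    by (simp add: sum.reindex[OF assms(2)] be)
  also have "\<dots> = (\<Sum>i<M. b i * 2 ^ (g * i))"
    by (intro sum.mono_neutral_left) (use sub in \<open>auto simp: b_def\<close>)
  also have "s2 \<dots> = (\<Sum>i<M. s2 (b i))"
    by (rule s2_sum_blocks) (auto simp: b_def assms(2,3) inv_into_into)
  also have "\<dots> = (\<Sum>i\<in>e ` X. s2 (b i))"
    by (intro sum.mono_neutral_right) (use sub in \<open>auto simp: b_def\<close>)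
  also have "\<dots> = (\<Sum>x\<in>X. s2 (a x))"
    by (simp add: sum.reindex[OF assms(2)] be)
  finally show ?thesis .
qed

text \<open>Here \<open>x\<close> is the bit at place \<open>S\<close>, and the bit above it is zero
  because of the factor \<open>4\<close>. So a carry out of place \<open>S\<close> moves up exactly
  one place and preserves the digit sum.\<close>

lemma s2_add_pow2_bit:
  assumes "l < 2 ^ S" "x < 2"
  shows "s2 (l + 2 ^ S * (x + 4 * h) + 2 ^ S) + x = s2 (l + 2 ^ S * (x + 4 * h)) + 1"
proof -
  have [simp]: "s2 2 = 1" using s2_pow2[of 1] by simp
  have "s2 (l + 2 ^ S * (x + 4 * h) + 2 ^ S) = s2 (l + 2 ^ S * ((x + 1) + 2 ^ 2 * h))"
    by (simp add: algebra_simps)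
  also have "\<dots> = s2 l + (s2 (x + 1) + s2 h)"
    using assms by (subst s2_add_pow2_mult, simp, subst s2_add_pow2_mult, auto)
  finally have 1: "s2 (l + 2 ^ S * (x + 4 * h) + 2 ^ S) = s2 l + (s2 (x + 1) + s2 h)" .
  have "s2 (l + 2 ^ S * (x + 4 * h)) = s2 (l + 2 ^ S * (x + 2 ^ 2 * h))"
    by simp
  also have "\<dots> = s2 l + (s2 x + s2 h)"
    using assms by (subst s2_add_pow2_mult, simp, subst s2_add_pow2_mult, auto)
  finally show ?thesis
    using assms(2) 1 by (auto simp: less_2_cases_iff numeral_2_eq_2[symmetric])
qed

subsection \<open>Digit sums of powers\<close>

text \<open>In the index pair, \<open>s\<close> counts the factors that do not contribute
  \<open>j\<close>, and \<open>i\<close> those among them that contribute the \<open>v\<close> term.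
  The power of \<open>Y\<close> is then
  \<open>K * (s - i) + (K - 1) * i = K * s - i\<close>.\<close>

lemma trinomial_blocks:
  fixes Y w v j :: nat
  assumes "K > 0"
  shows "(Y ^ K * w + Y ^ (K - 1) * v + j) ^ k =
    (\<Sum>(s, i)\<in>(SIGMA s:{..k}. {..s}).
       ((k choose s) * (s choose i) * w ^ (s - i) * v ^ i * j ^ (k - s)) * Y ^ (K * s - i))"
proof -
  have inner: "(Y ^ K * w + Y ^ (K - 1) * v) ^ s =
      (\<Sum>i\<le>s. (s choose i) * w ^ (s - i) * v ^ i * Y ^ (K * s - i))" for s
  proof -
    have "(Y ^ (K - 1) * v + Y ^ K * w) ^ s =
        (\<Sum>i\<le>s. (s choose i) * (Y ^ (K - 1) * v) ^ i * (Y ^ K * w) ^ (s - i))"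
      by (subst binomial_ring) simp
    also have "\<dots> = (\<Sum>i\<le>s. (s choose i) * w ^ (s - i) * v ^ i * Y ^ (K * s - i))"
    proof (intro sum.cong refl)
      fix i assume "i \<in> {..s}"
      then have "(K - 1) * i + K * (s - i) = K * s - i"
        using assms mult_le_mono2[of i s K] mult_le_mono1[of 1 K i]
        by (simp add: diff_mult_distrib diff_mult_distrib2)
      then have "Y ^ (K * s - i) = (Y ^ (K - 1)) ^ i * (Y ^ K) ^ (s - i)"
        by (simp only: power_mult[symmetric] power_add[symmetric])
      then show "(s choose i) * (Y ^ (K - 1) * v) ^ i * (Y ^ K * w) ^ (s - i) =
          (s choose i) * w ^ (s - i) * v ^ i * Y ^ (K * s - i)"
        by (simp only: power_mult_distrib mult_ac)
    qed
    finally show ?thesis by (simp add: add.commute)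
  qed
  have "(Y ^ K * w + Y ^ (K - 1) * v + j) ^ k =
      (\<Sum>s\<le>k. (k choose s) * (Y ^ K * w + Y ^ (K - 1) * v) ^ s * j ^ (k - s))"
    by (subst binomial_ring) simp
  also have "\<dots> = (\<Sum>s\<le>k. \<Sum>i\<le>s.
      ((k choose s) * (s choose i) * w ^ (s - i) * v ^ i * j ^ (k - s)) * Y ^ (K * s - i))"
    unfolding inner sum_distrib_left sum_distrib_right by (simp only: mult_ac)
  finally show ?thesis by (simp add: sum.Sigma)
qed

text \<open>As \<open>i < K\<close>, the residue of the exponent modulo \<open>K\<close> determines
  \<open>i\<close>, and then \<open>s\<close>.\<close>

lemma inj_on_block_exponent: "inj_on (\<lambda>(s, i). K * s - i) {(s, i). i \<le> s \<and> i < (K::nat)}"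
proof (rule inj_onI, clarify)
  fix s i s' i'
  assume *: "i \<le> s" "i < K" "i' \<le> s'" "i' < K" "K * s - i = K * s' - i'"
  then have "s \<le> K * s" "s' \<le> K * s'" by auto
  with * have eq: "K * s + i' = K * s' + i" by linarith
  then have "(K * s + i') mod K = (K * s' + i) mod K" by simp
  with * have "i = i'" by simp
  with eq * show "s = s' \<and> i = i'" by simp
qed

text \<open>The two binomial coefficients contribute at most \<open>2 ^ (k + s)\<close>, and the
  powers of \<open>w\<close>, \<open>v\<close> and \<open>j\<close> have total degree
  \<open>k\<close>.\<close>

lemma block_coeff_less:
  fixes w v j :: nat
  assumes "s \<le> k" "i \<le> s" "k \<le> K" "w \<le> 2 ^ m" "v \<le> 2 ^ m" "j \<le> 2 ^ m"
  shows "(k choose s) * (s choose i) * w ^ (s - i) * v ^ i * j ^ (k - s) \<le> 2 ^ (2 * K + m * K)"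
proof -
  have "(k choose s) * (s choose i) * w ^ (s - i) * v ^ i * j ^ (k - s)
      \<le> 2 ^ k * 2 ^ s * (2 ^ m) ^ (s - i) * (2 ^ m) ^ i * (2 ^ m) ^ (k - s)"
    using assms by (intro mult_le_mono power_mono binomial_le_pow2) auto
  also have "\<dots> = 2 ^ (k + s + m * ((s - i) + i + (k - s)))"
    by (simp add: power_add distrib_left flip: power_mult)
  also have "(s - i) + i + (k - s) = k" using assms by simp
  also have "(2::nat) ^ (k + s + m * k) \<le> 2 ^ (2 * K + m * K)"
    using assms by (intro power_increasing add_mono mult_left_mono) auto
  finally show ?thesis .
qed

text \<open>The right-hand side does not involve \<open>t\<close>: all exponents are distinct when
  \<open>k < K\<close>, and the factor \<open>2 ^ (t * i)\<close> merely shifts a coefficient inside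
  its block.\<close>

lemma s2_power_below_collision:
  assumes "k < K" "w \<le> 2 ^ m" "j \<le> 2 ^ m" "t \<le> m" "2 * K + m * K < g"
  shows "s2 (((2 ^ g) ^ K * w + (2 ^ g) ^ (K - 1) * 2 ^ t + j) ^ k) =
    (\<Sum>(s, i)\<in>(SIGMA s:{..k}. {..s}). s2 ((k choose s) * (s choose i) * w ^ (s - i) * j ^ (k - s)))"
proof -
  let ?X = "SIGMA s:{..k}. {..s}"
  define a where "a x = (case x of (s, i) \<Rightarrow>
    (k choose s) * (s choose i) * w ^ (s - i) * (2 ^ t) ^ i * j ^ (k - s))" for x
  define e where "e x = (case x of (s, i) \<Rightarrow> K * s - i)" for x :: "nat \<times> nat"
  have small: "a x < 2 ^ g" if xX: "x \<in> ?X" for x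
  proof -
    obtain s i where x: "x = (s, i)" "s \<le> k" "i \<le> s" using xX by auto
    have "a x \<le> 2 ^ (2 * K + m * K)"
      unfolding a_def x prod.case
      by (rule block_coeff_less) (use x assms in \<open>auto intro: power_increasing\<close>)
    also have "\<dots> < 2 ^ g" using assms by simp
    finally show ?thesis .
  qed
  have "((2 ^ g) ^ K * w + (2 ^ g) ^ (K - 1) * 2 ^ t + j) ^ k = (\<Sum>x\<in>?X. a x * 2 ^ (g * e x))"
    using assms(1) by (subst trinomial_blocks)
      (auto simp: a_def e_def power_mult intro!: sum.cong)
  also have "s2 \<dots> = (\<Sum>x\<in>?X. s2 (a x))"
  proof (rule s2_sum_inj)
    show "inj_on e ?X"
      unfolding e_def by (rule inj_on_subset[OF inj_on_block_exponent]) (use assms in auto)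
  qed (use small in auto)
  also have "\<dots> = (\<Sum>(s, i)\<in>?X. s2 ((k choose s) * (s choose i) * w ^ (s - i) * j ^ (k - s)))"
  proof (intro sum.cong refl, clarify)
    fix s i
    have "a (s, i) = 2 ^ (t * i) * ((k choose s) * (s choose i) * w ^ (s - i) * j ^ (k - s))"
      by (simp add: a_def mult_ac flip: power_mult)
    then show "s2 (a (s, i)) = s2 ((k choose s) * (s choose i) * w ^ (s - i) * j ^ (k - s))"
      by (simp only: s2_mult_pow2)
  qed
  finally show ?thesis .
qed

text \<open>The pairs \<open>(K, K)\<close> and \<open>(K - 1, 0)\<close> are the only ones with
  equal exponent, so their coefficients share a block. Only this block depends on \<open>t\<close>
  beyond a shift. Its coefficient may be twice as large as the others, hence the extra
  \<open>1\<close> in the bound on \<open>g\<close>.\<close>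

lemma s2_power_collision:
  assumes "K > 0" "w \<le> 2 ^ m" "j \<le> 2 ^ m" "t \<le> m" "2 * K + m * K + 1 < g"
  shows "s2 (((2 ^ g) ^ K * w + (2 ^ g) ^ (K - 1) * 2 ^ t + j) ^ K) =
    s2 (K * w ^ (K - 1) * j + 2 ^ (t * K)) +
    (\<Sum>(s, i)\<in>(SIGMA s:{..K}. {..s}) - {(K, K), (K - 1, 0)}.
       s2 ((K choose s) * (s choose i) * w ^ (s - i) * j ^ (K - s)))"
proof -
  let ?X = "SIGMA s:{..K}. {..s}"
  let ?X' = "?X - {(K, K), (K - 1, 0)}"
  define a where "a x = (case x of (s, i) \<Rightarrow>
    (K choose s) * (s choose i) * w ^ (s - i) * (2 ^ t) ^ i * j ^ (K - s))" for x
  define e where "e x = (case x of (s, i) \<Rightarrow> K * s - i)" for x :: "nat \<times> nat"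
  define a' where "a' x = (if x = (K - 1, 0) then a x + a (K, K) else a x)" for x
  have small: "a x \<le> 2 ^ (2 * K + m * K)" if xX: "x \<in> ?X" for x
  proof -
    obtain s i where x: "x = (s, i)" "s \<le> K" "i \<le> s" using xX by auto
    show ?thesis
      unfolding a_def x prod.case
      by (rule block_coeff_less) (use x assms in \<open>auto intro: power_increasing\<close>)
  qed
  have fin: "finite ?X'" by auto
  have X: "?X = insert (K, K) (insert (K - 1, 0) ?X')" using assms(1) by auto
  have nin: "(K, K) \<notin> insert (K - 1, 0) ?X'" "(K - 1, 0) \<notin> ?X'" using assms(1) by auto
  have "((2 ^ g) ^ K * w + (2 ^ g) ^ (K - 1) * 2 ^ t + j) ^ K = (\<Sum>x\<in>?X. a x * 2 ^ (g * e x))"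
    using assms(1) by (subst trinomial_blocks)
      (auto simp: a_def e_def power_mult intro!: sum.cong)
  also have "\<dots> = a (K, K) * 2 ^ (g * e (K, K)) + (a (K - 1, 0) * 2 ^ (g * e (K - 1, 0)) +
      (\<Sum>x\<in>?X'. a x * 2 ^ (g * e x)))"
    by (subst X) (use nin fin in simp)
  also have "e (K, K) = e (K - 1, 0)" by (simp add: e_def algebra_simps diff_mult_distrib2)
  also have "a (K, K) * 2 ^ (g * e (K - 1, 0)) + (a (K - 1, 0) * 2 ^ (g * e (K - 1, 0)) +
      (\<Sum>x\<in>?X'. a x * 2 ^ (g * e x))) = a' (K - 1, 0) * 2 ^ (g * e (K - 1, 0)) +
      (\<Sum>x\<in>?X'. a' x * 2 ^ (g * e x))"
    using nin by (auto simp: a'_def algebra_simps intro!: sum.cong)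
  also have "\<dots> = (\<Sum>x\<in>insert (K - 1, 0) ?X'. a' x * 2 ^ (g * e x))"
    using nin fin by simp
  also have "s2 \<dots> = (\<Sum>x\<in>insert (K - 1, 0) ?X'. s2 (a' x))"
  proof (rule s2_sum_inj)
    show "inj_on e (insert (K - 1, 0) ?X')"
      unfolding e_def by (rule inj_on_subset[OF inj_on_block_exponent]) (use assms in auto)
    fix x assume x: "x \<in> insert (K - 1, 0) ?X'"
    have "a' x \<le> 2 ^ (2 * K + m * K) + 2 ^ (2 * K + m * K)"
      unfolding a'_def using small[of x] small[of "(K, K)"] x assms(1) by auto
    also have "\<dots> = 2 ^ (2 * K + m * K + 1)" by simp
    also have "\<dots> < 2 ^ g" using assms(5) by (rule power_strict_increasing) simp
    finally show "a' x < 2 ^ g" .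
  qed (use fin in simp)
  also have "\<dots> = s2 (a (K - 1, 0) + a (K, K)) + (\<Sum>x\<in>?X'. s2 (a x))"
    using nin fin by (auto simp: a'_def intro!: sum.cong)
  also have "a (K - 1, 0) + a (K, K) = K * w ^ (K - 1) * j + 2 ^ (t * K)"
    using assms(1) by (cases K) (simp_all add: a_def power_add power_mult)
  also have "(\<Sum>x\<in>?X'. s2 (a x)) =
      (\<Sum>(s, i)\<in>?X'. s2 ((K choose s) * (s choose i) * w ^ (s - i) * j ^ (K - s)))"
  proof -
    have "a (s, i) = 2 ^ (t * i) * ((K choose s) * (s choose i) * w ^ (s - i) * j ^ (K - s))" for s i
      by (simp add: a_def mult_ac flip: power_mult)
    then have "s2 (a (s, i)) = s2 ((K choose s) * (s choose i) * w ^ (s - i) * j ^ (K - s))" for s i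
      by (simp only: s2_mult_pow2)
    then show ?thesis by (intro sum.cong) auto
  qed
  finally show ?thesis .
qed

section \<open>Pairs of arguments whose parities differ at a single index\<close>

text \<open>The number \<open>d\<close> is the largest one with
  \<open>K * d ^ (K - 1) * j0 < 2 ^ S\<close>. Since \<open>2 ^ S\<close> is large, so is
  \<open>d\<close>, and passing from \<open>d\<close> to \<open>Suc d\<close> changes the
  \<open>(K - 1)\<close>th power by a factor of at most \<open>(j0 + 1) / j0\<close>.\<close>

lemma consecutive_thresholds:
  fixes K j0 S :: nat
  assumes K: "K \<ge> 2" and j0: "j0 \<ge> 1" and S: "(2 * K * j0) ^ K \<le> 2 ^ S"
  obtains d where "Suc d \<le> 2 ^ S" "K * d ^ (K - 1) * j0 < 2 ^ S" "2 ^ S \<le> K * Suc d ^ (K - 1) * j0"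
    "2 ^ S \<le> K * d ^ (K - 1) * (j0 + 1)" "K * Suc d ^ (K - 1) * (j0 - 1) < 2 ^ S"
proof -
  define Q where "Q d \<longleftrightarrow> 2 ^ S \<le> K * d ^ (K - 1) * j0" for d
  define d1 where "d1 = (LEAST d. Q d)"
  have "Q (2 ^ S)"
  proof -
    have "(2::nat) ^ S = 1 * (2 ^ S) ^ 1 * 1" by simp
    also have "\<dots> \<le> K * (2 ^ S) ^ (K - 1) * j0"
      using K j0 by (intro mult_le_mono power_increasing) auto
    finally show ?thesis by (simp add: Q_def)
  qed
  then have Qd1: "Q d1" and d1_le: "d1 \<le> 2 ^ S"
    unfolding d1_def by (auto intro: LeastI Least_le)
  have "\<not> Q 0" using K by (simp add: Q_def power_0_left)
  with Qd1 obtain d where d: "d1 = Suc d" by (cases d1) auto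
  have nQ: "\<not> Q d" using not_less_Least[of d Q] d unfolding d1_def by simp
  \<comment> \<open>Otherwise \<open>d1 \<le> 2 * K * j0\<close>, and
    \<open>K * d1 ^ (K - 1) * j0\<close> would be below
    \<open>(2 * K * j0) ^ K \<le> 2 ^ S\<close>.\<close>
  have large: "(K - 1) * (j0 + 1) < d1"
  proof (rule ccontr)
    assume "\<not> ?thesis"
    then have *: "d1 \<le> (K - 1) * (j0 + 1)" by simp
    have "d1 \<le> K * (2 * j0)"
      using * j0 by (rule_tac order_trans[OF *], intro mult_le_mono) auto
    then have "d1 ^ (K - 1) \<le> (2 * K * j0) ^ (K - 1)"
      by (intro power_mono) (auto simp: mult_ac)
    then have "K * d1 ^ (K - 1) * j0 \<le> K * (2 * K * j0) ^ (K - 1) * j0"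
      by simp
    also have "\<dots> < (2 * K * j0) * (2 * K * j0) ^ (K - 1)"
      using K j0 by simp
    also have "\<dots> = (2 * K * j0) ^ K"
      using K by (cases K) auto
    finally show False using S Qd1 by (simp add: Q_def)
  qed
  \<comment> \<open>Bernoulli: \<open>(d / d1) ^ (K - 1) \<ge> 1 - (K - 1) / d1\<close>, and by
    \<open>large\<close> this is at least \<open>1 - 1 / (j0 + 1)\<close>.\<close>
  have ratio: "d1 ^ (K - 1) * j0 \<le> d ^ (K - 1) * (j0 + 1)"
  proof -
    have pos: "real d1 > 0" "real j0 + 1 > 0" using d by auto
    have l: "real (K - 1) * (real j0 + 1) \<le> real d1"
    proof -
      have "real ((K - 1) * (j0 + 1)) \<le> real d1" using large by (simp only: of_nat_le_iff)
      then show ?thesis by (simp only: of_nat_mult of_nat_add of_nat_1)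
    qed
    have "real j0 / (real j0 + 1) = 1 - 1 / (real j0 + 1)" by (simp add: field_simps)
    also have "\<dots> \<le> 1 - real (K - 1) / real d1"
      using l pos by (simp add: field_simps)
    also have "\<dots> = 1 + real (K - 1) * (- 1 / real d1)" by simp
    also have "\<dots> \<le> (1 + (- 1 / real d1)) ^ (K - 1)"
      by (rule Bernoulli_inequality) (use d in simp)
    also have "1 + (- 1 / real d1) = real d / real d1" using d by (simp add: field_simps)
    finally have "real j0 / (real j0 + 1) \<le> real d ^ (K - 1) / real d1 ^ (K - 1)"
      by (simp add: power_divide)
    then have "real j0 * real d1 ^ (K - 1) \<le> real d ^ (K - 1) * (real j0 + 1)"
      using pos by (simp add: divide_simps mult_ac)
    then have "real (d1 ^ (K - 1) * j0) \<le> real (d ^ (K - 1) * (j0 + 1))"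
      by (simp add: algebra_simps)
    then show ?thesis by (simp only: of_nat_le_iff)
  qed
  then have ratio': "K * d1 ^ (K - 1) * j0 \<le> K * d ^ (K - 1) * (j0 + 1)"
    by (metis mult.assoc mult_le_mono2)
  \<comment> \<open>Multiply by \<open>j0\<close>, apply the ratio bound and use
    \<open>(j0 + 1) * (j0 - 1) \<le> j0 * j0\<close>.\<close>
  have "K * d1 ^ (K - 1) * (j0 - 1) < 2 ^ S"
  proof -
    have "K * d1 ^ (K - 1) * (j0 - 1) * j0 \<le> K * d ^ (K - 1) * (j0 + 1) * (j0 - 1)"
      using mult_le_mono1[OF ratio', of "j0 - 1"] by (simp add: mult_ac)
    also have "\<dots> = K * d ^ (K - 1) * ((j0 + 1) * (j0 - 1))" by (simp only: mult.assoc)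
    also have "\<dots> \<le> K * d ^ (K - 1) * (j0 * j0)"
      using j0 by (intro mult_le_mono2) (cases j0, auto)
    also have "\<dots> < 2 ^ S * j0" using nQ j0 by (simp add: Q_def mult.assoc[symmetric])
    finally show ?thesis by simp
  qed
  moreover have "2 ^ S \<le> K * d ^ (K - 1) * (j0 + 1)"
    using ratio' Qd1 by (simp add: Q_def)
  ultimately show ?thesis
    using that[of d] d1_le nQ Qd1 d by (simp add: Q_def)
qed

text \<open>A mean value estimate; it bounds the part of \<open>w ^ (K - 1)\<close> that lies below
  the leading term.\<close>

lemma power_add_lower:
  fixes a b :: nat
  shows "(a + b) ^ n \<le> b ^ n + n * a * (a + b) ^ (n - 1)"
proof (induction n)
  case (Suc n)
  have "(a + b) ^ Suc n = b * (a + b) ^ n + a * (a + b) ^ n" by (simp add: algebra_simps)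
  also have "\<dots> \<le> b * (b ^ n + n * a * (a + b) ^ (n - 1)) + a * (a + b) ^ n"
    using Suc.IH by simp
  also have "\<dots> = b ^ Suc n + n * a * (b * (a + b) ^ (n - 1)) + a * (a + b) ^ n"
    by (simp add: algebra_simps)
  also have "\<dots> \<le> b ^ Suc n + n * a * (a + b) ^ n + a * (a + b) ^ n"
  proof (cases n)
    case (Suc n')
    have "b * (a + b) ^ n' \<le> (a + b) * (a + b) ^ n'" by (intro mult_le_mono1) simp
    then have "n * a * (b * (a + b) ^ n') \<le> n * a * ((a + b) * (a + b) ^ n')" by (intro mult_le_mono2)
    then show ?thesis by (simp add: Suc)
  qed simp
  finally show ?case by (simp add: algebra_simps)
qed simp

lemma power_add_mult_mod:
  fixes a m c :: nat
  shows "\<exists>r. (a + m * c) ^ n = a ^ n + m * r"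
proof (induction n)
  case (Suc n)
  then obtain r where r: "(a + m * c) ^ n = a ^ n + m * r" by blast
  have "(a + m * c) ^ Suc n = a ^ Suc n + m * (a * r + c * (a ^ n + m * r))"
    by (simp only: power_Suc r) (simp add: algebra_simps)
  then show ?case by blast
qed simp

text \<open>For a number with top block \<open>n\<close>: since \<open>n < 2 ^ Suc S\<close>, the
  bit of \<open>n\<close> at place \<open>S\<close> tells whether \<open>2 ^ S \<le> n\<close>, and
  a carry from there meets only zeros.\<close>

lemma s2_add_pow2_window:
  assumes n: "n < 2 ^ Suc S" and l: "l < 2 ^ h"
  shows "s2 (l + 2 ^ h * n + 2 ^ (h + S)) + (if 2 ^ S \<le> n then 1 else 0) = s2 (l + 2 ^ h * n) + 1"
proof -
  let ?x = "n div 2 ^ S" and ?r = "n mod 2 ^ S"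
  have x: "?x < 2" using n by (simp add: less_mult_imp_div_less)
  have eq: "l + 2 ^ h * n = (l + 2 ^ h * ?r) + 2 ^ (h + S) * (?x + 4 * 0)"
    using mod_mult_div_eq[of n "2 ^ S"] by (simp add: power_add mult.assoc flip: distrib_left)
  have "l + 2 ^ h * ?r < 2 ^ h * (?r + 1)" using l by simp
  also have "\<dots> \<le> 2 ^ h * 2 ^ S" by (intro mult_le_mono2) (simp add: Suc_leI)
  finally have "l + 2 ^ h * ?r < 2 ^ (h + S)" by (simp add: power_add)
  from s2_add_pow2_bit[OF this x, of 0] have
    "s2 (l + 2 ^ h * n + 2 ^ (h + S)) + ?x = s2 (l + 2 ^ h * n) + 1" by (simp only: eq)
  moreover have "?x = (if 2 ^ S \<le> n then 1 else 0)"
    using x by (auto simp: less_2_cases_iff div_eq_0_iff Suc_lessI not_le)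
  ultimately show ?thesis by simp
qed

text \<open>The counterpart for the lowest block: \<open>S + 2 \<le> h\<close> leaves room for the
  carry, so \<open>m\<close> is not affected.\<close>

lemma s2_add_pow2_window_low:
  assumes n: "n < 2 ^ Suc S" and h: "S + 2 \<le> h"
  shows "s2 (n + 2 ^ h * m + 2 ^ S) + (if 2 ^ S \<le> n then 1 else 0) = s2 (n + 2 ^ h * m) + 1"
proof -
  have "n + 2 ^ S < 2 ^ h"
  proof -
    have "n + 2 ^ S < 2 ^ (S + 2)" using n by simp
    also have "\<dots> \<le> 2 ^ h" using h by (intro power_increasing) auto
    finally show ?thesis .
  qed
  then have "s2 (n + 2 ^ h * m + 2 ^ S) = s2 (n + 2 ^ S) + s2 m" "s2 (n + 2 ^ h * m) = s2 n + s2 m"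
    using s2_add_pow2_mult[of "n + 2 ^ S" h m] s2_add_pow2_mult[of n h m] by (simp_all add: ac_simps)
  moreover have "s2 (n + 2 ^ S) + (if 2 ^ S \<le> n then 1 else 0) = s2 n + 1"
    using s2_add_pow2_window[OF n, of 0 0] by simp
  ultimately show ?thesis by linarith
qed

text \<open>
  The lowest block of \<open>K * w ^ (K - 1) * j\<close> is \<open>K * Suc d ^ (K - 1) * j\<close> and the highest one is
  \<open>K * d ^ (K - 1) * j\<close>. These exceed \<open>2 ^ S\<close> for \<open>j \<ge> j0\<close> and for \<open>j \<ge> j0 + 1\<close> respectively,
  so the two carries differ for \<open>j = j0\<close> only.
\<close>

lemma parity_separation:
  fixes K j0 S h d :: nat
  assumes K: "K \<ge> 2" and j0: "j0 \<ge> 1"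
    and d: "K * d ^ (K - 1) * j0 < 2 ^ S" "2 ^ S \<le> K * Suc d ^ (K - 1) * j0"
      "2 ^ S \<le> K * d ^ (K - 1) * (j0 + 1)" "K * Suc d ^ (K - 1) * (j0 - 1) < 2 ^ S"
    and h: "S + 2 \<le> h" "Suc d \<le> 2 ^ h" "K * K * Suc d ^ (K - 1) * (2 * j0) < 2 ^ h"
    and j: "j \<le> 2 * j0 - 2"
  defines "w \<equiv> Suc d + 2 ^ h * d"
  shows "even (s2 (K * w ^ (K - 1) * j + 2 ^ S)) \<noteq> even (s2 (K * w ^ (K - 1) * j + 2 ^ (h * (K - 1) + S)))
    \<longleftrightarrow> j = j0"
proof -
  define n1 where "n1 = K * Suc d ^ (K - 1) * j"
  define n2 where "n2 = K * d ^ (K - 1) * j"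
  \<comment> \<open>Here the bound \<open>2 * j0 - 2\<close> on \<open>j\<close> is used: it keeps
    both blocks below twice the threshold, so that each can carry out of place \<open>S\<close> in
    one way only.\<close>
  have n1: "n1 < 2 ^ Suc S"
  proof -
    have "n1 \<le> K * Suc d ^ (K - 1) * (2 * (j0 - 1))"
      unfolding n1_def using j by (intro mult_le_mono2) simp
    also have "\<dots> = 2 * (K * Suc d ^ (K - 1) * (j0 - 1))" by (simp only: mult_ac)
    also have "\<dots> < 2 * 2 ^ S" using d(4) by (simp only: nat_mult_less_cancel1 zero_less_numeral)
    finally show ?thesis by simp
  qed
  have "n2 \<le> n1"
    unfolding n1_def n2_def by (intro mult_le_mono1 mult_le_mono2 power_mono) auto
  with n1 have n2: "n2 < 2 ^ Suc S" by simp
  have mono: "c * x \<le> c * y" if "x \<le> y" for c x y :: nat using that by simp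
  have iff1: "2 ^ S \<le> n1 \<longleftrightarrow> j0 \<le> j"
  proof
    assume "2 ^ S \<le> n1"
    show "j0 \<le> j"
    proof (rule ccontr)
      assume "\<not> j0 \<le> j"
      then have "n1 \<le> K * Suc d ^ (K - 1) * (j0 - 1)" unfolding n1_def by (intro mono) simp
      with d(4) \<open>2 ^ S \<le> n1\<close> show False by simp
    qed
  next
    assume "j0 \<le> j"
    then have "K * Suc d ^ (K - 1) * j0 \<le> n1" unfolding n1_def by (rule mono)
    with d(2) show "2 ^ S \<le> n1" by simp
  qed
  have iff2: "2 ^ S \<le> n2 \<longleftrightarrow> j0 < j"
  proof
    assume "2 ^ S \<le> n2"
    show "j0 < j"
    proof (rule ccontr)
      assume "\<not> j0 < j"
      then have "n2 \<le> K * d ^ (K - 1) * j0" unfolding n2_def by (intro mono) simp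
      with d(1) \<open>2 ^ S \<le> n2\<close> show False by simp
    qed
  next
    assume "j0 < j"
    then have "K * d ^ (K - 1) * (j0 + 1) \<le> n2" unfolding n2_def by (intro mono) simp
    with d(3) show "2 ^ S \<le> n2" by simp
  qed
  let ?W = "K * w ^ (K - 1) * j"
  obtain r where "w ^ (K - 1) = Suc d ^ (K - 1) + 2 ^ h * r"
    using power_add_mult_mod[of "Suc d" "2 ^ h" d "K - 1"] by (auto simp: w_def)
  then have W1: "?W = n1 + 2 ^ h * (K * r * j)" by (simp only: n1_def distrib_left distrib_right mult_ac)
  \<comment> \<open>\<open>A\<close> collects all terms of \<open>w ^ (K - 1)\<close> except the
    leading one. The bound \<open>low\<close> keeps \<open>K * A * j\<close> below the block of
    \<open>n2\<close>, so \<open>n2\<close> is indeed the highest block.\<close>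
  have "(2 ^ h * d) ^ (K - 1) \<le> w ^ (K - 1)"
    by (intro power_mono) (simp_all add: w_def)
  then obtain A where A: "w ^ (K - 1) = A + (2 ^ h * d) ^ (K - 1)"
    by (metis le_iff_add add.commute)
  have wle: "w \<le> 2 ^ h * Suc d" using h(2) by (simp add: w_def)
  have "A \<le> (K - 1) * Suc d * w ^ (K - 2)"
    using power_add_lower[of "Suc d" "2 ^ h * d" "K - 1"] A by (simp add: w_def numeral_2_eq_2)
  also have "\<dots> \<le> K * Suc d * (2 ^ h * Suc d) ^ (K - 2)"
    by (intro mult_le_mono power_mono wle) auto
  also have "\<dots> = K * Suc d ^ (K - 1) * (2 ^ h) ^ (K - 2)"
  proof -
    obtain k where "K = Suc (Suc k)" using K by (metis add_2_eq_Suc le_Suc_ex)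
    then show ?thesis by (simp add: power_mult_distrib mult_ac del: mult_Suc mult_Suc_right)
  qed
  finally have A_le: "A \<le> K * Suc d ^ (K - 1) * (2 ^ h) ^ (K - 2)" .
  have "K * A * j \<le> K * (K * Suc d ^ (K - 1) * (2 ^ h) ^ (K - 2)) * (2 * j0)"
    using A_le j by (intro mult_le_mono) auto
  also have "\<dots> = K * K * Suc d ^ (K - 1) * (2 * j0) * (2 ^ h) ^ (K - 2)" by (simp only: mult_ac)
  also have "\<dots> < 2 ^ h * (2 ^ h) ^ (K - 2)" using h(3) by simp
  also have "\<dots> = (2 ^ h) ^ (K - 1)"
    using K by (simp flip: power_Suc add: Suc_diff_Suc numeral_2_eq_2)
  finally have low: "K * A * j < 2 ^ (h * (K - 1))" by (simp add: power_mult)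
  have W2: "?W = K * A * j + 2 ^ (h * (K - 1)) * n2"
    by (simp only: A n2_def power_mult_distrib power_mult distrib_left distrib_right mult_ac)
  have e1: "s2 (?W + 2 ^ S) + (if j0 \<le> j then 1 else 0) = s2 ?W + 1"
    using s2_add_pow2_window_low[OF n1 h(1), of "K * r * j"] by (simp only: W1 iff1)
  have e2: "s2 (?W + 2 ^ (h * (K - 1) + S)) + (if j0 < j then 1 else 0) = s2 ?W + 1"
    using s2_add_pow2_window[OF n2 low] by (simp only: W2 iff2)
  consider "j < j0" | "j = j0" | "j > j0" by linarith
  then show ?thesis
  proof cases
    case 1
    then have "s2 (?W + 2 ^ S) = s2 (?W + 2 ^ (h * (K - 1) + S))" using e1 e2 by simp
    with 1 show ?thesis by simp
  next
    case 2
    then have "s2 (?W + 2 ^ (h * (K - 1) + S)) = Suc (s2 (?W + 2 ^ S))" using e1 e2 by simp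
    with 2 show ?thesis by simp
  next
    case 3
    then have "s2 (?W + 2 ^ S) = s2 (?W + 2 ^ (h * (K - 1) + S))" using e1 e2 by simp
    with 3 show ?thesis by simp
  qed
qed

lemma thue_morse_eq_iff: "thue_morse m = thue_morse n \<longleftrightarrow> even (s2 m) = even (s2 n)"
  by (simp add: thue_morse_def)

text \<open>The two values of the shift must turn \<open>2 ^ (t * K)\<close> into
  \<open>2 ^ S\<close> and \<open>2 ^ (h * (K - 1) + S)\<close>. So \<open>S\<close> and
  \<open>h = K * e\<close> are multiples of \<open>K\<close>; moreover \<open>S\<close> satisfies
  the bound for \<open>j0 = 2 ^ b\<close>, and \<open>e\<close> makes the blocks of \<open>w\<close>
  wide enough. Finally \<open>2 ^ m\<close> bounds \<open>w\<close>, \<open>j\<close> and both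
  shifts, and \<open>g\<close> bits hold every coefficient.\<close>

lemma separating_pair:
  fixes K b :: nat
  assumes K: "K \<ge> 2"
  defines "S \<equiv> (b + 1 + K) * K"
  defines "e \<equiv> 2 * K + b + 2 + K * S"
  defines "m \<equiv> K * e + S + b + 1 + K"
  defines "g \<equiv> 2 * K + m * K + 2"
  shows "\<exists>N N'. N \<le> 2 ^ (g * K + m + 1) \<and> N' \<le> 2 ^ (g * K + m + 1) \<and>
    (\<forall>j\<le>2 * 2 ^ b - 2. (\<forall>k<K. thue_morse ((N + j) ^ k) = thue_morse ((N' + j) ^ k)) \<and>
       (thue_morse ((N + j) ^ K) \<noteq> thue_morse ((N' + j) ^ K) \<longleftrightarrow> j = 2 ^ b))"
proof -
  define h where "h = K * e"
  define t where "t = b + 1 + K"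
  define t' where "t' = t + e * (K - 1)"
  define j0 where "j0 = (2::nat) ^ b"
  have j0: "j0 \<ge> 1" by (simp add: j0_def)
  have K2: "K \<le> 2 ^ K" by (simp add: less_imp_le)
  have "2 * K * j0 \<le> 2 ^ (b + 1 + K)" using K2 by (simp add: j0_def power_add)
  then have S: "(2 * K * j0) ^ K \<le> 2 ^ S" unfolding S_def power_mult by (rule power_mono) simp
  obtain d where d1: "Suc d \<le> 2 ^ S" and
    d: "K * d ^ (K - 1) * j0 < 2 ^ S" "2 ^ S \<le> K * Suc d ^ (K - 1) * j0"
    "2 ^ S \<le> K * d ^ (K - 1) * (j0 + 1)" "K * Suc d ^ (K - 1) * (j0 - 1) < 2 ^ S"
    using consecutive_thresholds[OF K j0 S] by blast
  have eh: "e \<le> h" using K by (simp add: h_def)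
  have "S \<le> K * S" using K by simp
  then have h1: "S + 2 \<le> h" using eh unfolding e_def by linarith
  have h2: "Suc d \<le> 2 ^ h"
    using d1 h1 by (meson add_leD1 order_trans one_le_numeral power_increasing)
  have h3: "K * K * Suc d ^ (K - 1) * (2 * j0) < 2 ^ h"
  proof -
    have "K * K * Suc d ^ (K - 1) * (2 * j0) \<le> 2 ^ K * 2 ^ K * (2 ^ S) ^ (K - 1) * (2 * 2 ^ b)"
      using K2 d1 by (intro mult_le_mono power_mono) (auto simp: j0_def)
    also have "\<dots> = 2 ^ (K + K + S * (K - 1) + (b + 1))" by (simp add: power_add power_mult)
    also have "\<dots> < 2 ^ e"
      by (rule power_strict_increasing) (auto simp: e_def algebra_simps intro!: le_imp_less_Suc trans_le_add1 mult_le_mono)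
    also have "\<dots> \<le> 2 ^ h" using eh by (rule power_increasing) simp
    finally show ?thesis .
  qed
  define w where "w = Suc d + 2 ^ h * d"
  have wm: "w \<le> 2 ^ m"
  proof -
    have "w \<le> 2 ^ h * Suc d" using h2 by (simp add: w_def)
    also have "\<dots> \<le> 2 ^ h * 2 ^ S" using d1 by (rule mult_le_mono2)
    also have "\<dots> = 2 ^ (h + S)" by (simp add: power_add)
    also have "\<dots> \<le> 2 ^ m" by (rule power_increasing) (auto simp: m_def h_def)
    finally show ?thesis .
  qed
  have tm: "t \<le> m" by (simp add: t_def m_def)
  have "e * (K - 1) \<le> K * e" by simp
  then have t'm: "t' \<le> m" unfolding t'_def t_def m_def by linarith
  have tK: "t * K = S" by (simp add: t_def S_def)
  have t'K: "t' * K = h * (K - 1) + S"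
    unfolding t'_def add_mult_distrib tK by (simp add: h_def mult_ac)
  define N where "N x = (2 ^ g) ^ K * w + (2 ^ g) ^ (K - 1) * 2 ^ x" for x :: nat
  have N_le: "N x \<le> 2 ^ (g * K + m + 1)" if "x \<le> m" for x
  proof -
    have "N x \<le> (2 ^ g) ^ K * 2 ^ m + (2 ^ g) ^ K * 2 ^ m"
      unfolding N_def using wm that
      by (intro add_mono mult_le_mono power_increasing) auto
    then show ?thesis by (simp add: power_add power_mult)
  qed
  have jm: "j \<le> 2 ^ m" if "j \<le> 2 * 2 ^ b - 2" for j :: nat
  proof -
    have "j \<le> 2 ^ (b + 1)" using that by simp
    also have "\<dots> \<le> 2 ^ m" by (rule power_increasing) (auto simp: m_def)
    finally show ?thesis .
  qed
  show ?thesis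
  proof (rule exI[of _ "N t"], rule exI[of _ "N t'"], intro conjI allI impI)
    fix j :: nat assume j: "j \<le> 2 * 2 ^ b - 2"
    show "thue_morse ((N t + j) ^ k) = thue_morse ((N t' + j) ^ k)" if "k < K" for k
      unfolding thue_morse_eq_iff N_def
      using that wm jm[OF j] tm t'm by (subst (1 2) s2_power_below_collision[where m = m]) (auto simp: g_def)
    show "thue_morse ((N t + j) ^ K) \<noteq> thue_morse ((N t' + j) ^ K) \<longleftrightarrow> j = 2 ^ b"
      unfolding thue_morse_eq_iff N_def
      using parity_separation[OF K j0 d h1 h2 h3, of j] j K wm jm[OF j] tm t'm
      by (subst (1 2) s2_power_collision[where m = m]) (auto simp: g_def tK t'K w_def j0_def)
  qed (use N_le tm t'm in auto)
qed

lemma separating_pairs: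
  fixes K :: nat
  assumes K: "K \<ge> 2"
  shows "\<exists>A. \<forall>b\<ge>1. \<exists>N N'. N \<le> 2 ^ (A * b) \<and> N' \<le> 2 ^ (A * b) \<and>
    (\<forall>j\<le>2 * 2 ^ b - 2. (\<forall>k<K. thue_morse ((N + j) ^ k) = thue_morse ((N' + j) ^ k)) \<and>
       (thue_morse ((N + j) ^ K) \<noteq> thue_morse ((N' + j) ^ K) \<longleftrightarrow> j = 2 ^ b))"
proof -
  define S where "S b = (b + 1 + K) * K" for b
  define e where "e b = 2 * K + b + 2 + K * S b" for b
  define m where "m b = K * e b + S b + b + 1 + K" for b
  define g where "g b = 2 * K + m b * K + 2" for b
  define B where "B b = g b * K + m b + 1" for b
  \<comment> \<open>\<open>C\<close> is the slope of \<open>m\<close> in \<open>b\<close>, so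
    \<open>B\<close> is affine with slope \<open>C * K * K + C\<close>. For \<open>b \<ge> 1\<close>
    an affine function is at most a multiple of \<open>b\<close>.\<close>
  define C where "C = K * (1 + K * K) + K + 1"
  have "B b = B 0 + (C * K * K + C) * b" for b
    by (simp add: B_def g_def m_def e_def S_def C_def algebra_simps)
  moreover have "B 0 + c * b \<le> (B 0 + c) * b" if "b \<ge> 1" for b c
    using that by (simp add: algebra_simps)
  ultimately have "B b \<le> (B 0 + (C * K * K + C)) * b" if "b \<ge> 1" for b
    using that by metis
  then have le: "x \<le> 2 ^ ((B 0 + (C * K * K + C)) * b)" if "b \<ge> 1" "x \<le> 2 ^ B b" for x b :: nat
    using that by (meson one_le_numeral order_trans power_increasing)
  show ?thesis
  proof (rule exI[of _ "B 0 + (C * K * K + C)"], intro allI impI)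
    fix b :: nat assume b: "b \<ge> 1"
    show "\<exists>N N'. N \<le> 2 ^ ((B 0 + (C * K * K + C)) * b) \<and> N' \<le> 2 ^ ((B 0 + (C * K * K + C)) * b) \<and>
      (\<forall>j\<le>2 * 2 ^ b - 2. (\<forall>k<K. thue_morse ((N + j) ^ k) = thue_morse ((N' + j) ^ k)) \<and>
       (thue_morse ((N + j) ^ K) \<noteq> thue_morse ((N' + j) ^ K) \<longleftrightarrow> j = 2 ^ b))"
    proof -
      have "\<exists>N N'. N \<le> 2 ^ B b \<and> N' \<le> 2 ^ B b \<and>
        (\<forall>j\<le>2 * 2 ^ b - 2. (\<forall>k<K. thue_morse ((N + j) ^ k) = thue_morse ((N' + j) ^ k)) \<and>
         (thue_morse ((N + j) ^ K) \<noteq> thue_morse ((N' + j) ^ K) \<longleftrightarrow> j = 2 ^ b))"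
        unfolding B_def g_def m_def e_def S_def by (rule separating_pair[OF K])
      then show ?thesis using le[OF b] by meson
    qed
  qed
qed

subsection \<open>Norms of algebraic integers\<close>

text \<open>Pseudo-division multiplies \<open>p\<close> by a power of the leading coefficient of
  \<open>m\<close>, which is \<open>1\<close> here.\<close>

lemma int_poly_division_monic:
  fixes p m :: "int poly"
  assumes "lead_coeff m = 1"
  obtains q r where "p = m * q + r" "r = 0 \<or> degree r < degree m"
proof -
  obtain q r where qr: "pseudo_divmod p m = (q, r)" by fastforce
  have "m \<noteq> 0" using assms by auto
  from pseudo_divmod[OF this qr] assms show ?thesis using that by simp
qed

text \<open>
  The product is the determinant of multiplication by \<open>q\<close> on \<open>\<int>[x]/(m)\<close>: the
  Vandermonde matrix of the roots diagonalises it.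
\<close>

lemma prod_roots_int_poly:
  fixes m q :: "int poly" and Z :: "complex set"
  assumes m: "lead_coeff m = 1"
    and Z: "finite Z" "card Z = degree m" "\<And>z. z \<in> Z \<Longrightarrow> poly (map_poly of_int m) z = 0"
  shows "(\<Prod>z\<in>Z. poly (map_poly of_int q) z) \<in> \<int>"
proof -
  define d where "d = degree m"
  \<comment> \<open>The remainder of \<open>x ^ i * q\<close> modulo \<open>m\<close> supplies
    column \<open>i\<close> of the integer matrix \<open>M\<close>. At a root \<open>z\<close> of
    \<open>m\<close> it takes the value of \<open>x ^ i * q\<close> itself.\<close>
  have "\<forall>i. \<exists>r. (\<exists>s. monom 1 i * q = m * s + r) \<and> (r = 0 \<or> degree r < d)"
    unfolding d_def using int_poly_division_monic[OF m] by metis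
  then obtain r where r: "\<And>i. \<exists>s. monom 1 i * q = m * s + r i"
    "\<And>i. r i = 0 \<or> degree (r i) < d" by metis
  have eval: "z ^ i * poly (map_poly of_int q) z = (\<Sum>j<d. of_int (coeff (r i) j) * z ^ j)"
    if "z \<in> Z" for z i
  proof -
    obtain s where s: "monom 1 i * q = m * s + r i" using r(1) by blast
    have "z ^ i * poly (map_poly of_int q) z = poly (map_poly of_int (monom 1 i * q)) z"
      by (simp add: of_int_poly_hom.hom_mult map_poly_monom poly_monom)
    also have "\<dots> = poly (map_poly of_int (r i)) z"
      using Z(3)[OF that] by (simp add: s of_int_poly_hom.hom_mult of_int_poly_hom.hom_add)
    also have "\<dots> = (\<Sum>j<d. of_int (coeff (r i) j) * z ^ j)"
    proof -
      have "(\<Sum>j\<le>degree (r i). complex_of_int (coeff (r i) j) * z ^ j) =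
          (\<Sum>j<d. of_int (coeff (r i) j) * z ^ j)"
        using r(2)[of i] by (intro sum.mono_neutral_cong) (auto simp: coeff_eq_0 not_le)
      then show ?thesis by (simp add: poly_altdef)
    qed
    finally show ?thesis .
  qed
  obtain zs where zs: "set zs = Z" "distinct zs" using finite_distinct_list[OF Z(1)] by blast
  then have len: "length zs = d" using distinct_card[OF zs(2)] Z(2) by (simp add: d_def)
  define V where "V = mat d d (\<lambda>(k, j). zs ! k ^ j)"
  define M where "M = mat d d (\<lambda>(j, i). coeff (r i) j)"
  define D where "D = mat d d (\<lambda>(k, l). if k = l then poly (map_poly of_int q) (zs ! k) else 0)"
  have car: "V \<in> carrier_mat d d" "M \<in> carrier_mat d d" "D \<in> carrier_mat d d"
    by (auto simp: V_def M_def D_def)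
  have "V * map_mat of_int M = D * V"
  proof (rule eq_matI)
    fix k i assume "k < dim_row (D * V)" "i < dim_col (D * V)"
    then have ki: "k < d" "i < d" by (auto simp: D_def V_def)
    have "(V * map_mat of_int M) $$ (k, i) = (\<Sum>j<d. zs ! k ^ j * of_int (coeff (r i) j))"
      using ki by (auto simp: V_def M_def scalar_prod_def atLeast0LessThan)
    also have "\<dots> = zs ! k ^ i * poly (map_poly of_int q) (zs ! k)"
      using eval[of "zs ! k" i] ki len zs(1) by (auto simp: mult.commute)
    also have "\<dots> = (\<Sum>j<d. (if k = j then poly (map_poly of_int q) (zs ! k) else 0) * zs ! j ^ i)"
      using ki by (simp add: if_distrib[of "\<lambda>x. x * _"] sum.delta' cong: if_cong)
    also have "\<dots> = (D * V) $$ (k, i)"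
      using ki by (auto simp: V_def D_def scalar_prod_def atLeast0LessThan)
    finally show "(V * map_mat of_int M) $$ (k, i) = (D * V) $$ (k, i)" .
  qed (auto simp: V_def M_def D_def)
  then have "det V * of_int (det M) = det D * det V"
    using car by (simp add: det_mult[symmetric] flip: of_int_hom.hom_det)
  \<comment> \<open>A kernel vector of \<open>V\<close> would be the coefficient vector of a nonzero
    polynomial of degree below \<open>d\<close> with \<open>d\<close> distinct roots.\<close>
  moreover have "det V \<noteq> 0"
  proof
    assume "det V = 0"
    then obtain v where v: "v \<in> carrier_vec d" "v \<noteq> 0\<^sub>v d" "V *\<^sub>v v = 0\<^sub>v d"
      using det_0_iff_vec_prod_zero_field[OF car(1)] by blast
    define p where "p = (\<Sum>j<d. monom (v $ j) j)"
    have p_coeff: "coeff p j = (if j < d then v $ j else 0)" for j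
      by (simp add: p_def coeff_sum if_distrib sum.delta cong: if_cong)
    have "\<exists>i<d. v $ i \<noteq> 0"
    proof (rule ccontr)
      assume "\<not> ?thesis"
      then have "v = 0\<^sub>v d" using v(1) by (intro eq_vecI) auto
      with v(2) show False ..
    qed
    then obtain i where "i < d" "v $ i \<noteq> 0" by blast
    then have "p \<noteq> 0" using p_coeff[of i] by auto
    have "degree p < d"
      using \<open>i < d\<close> by (intro degree_lessI) (auto simp: p_coeff)
    have "poly p z = 0" if zZ: "z \<in> Z" for z
    proof -
      obtain k where k: "k < d" "z = zs ! k" using zZ zs(1) len in_set_conv_nth[of z zs] by auto
      have "poly p z = (\<Sum>j<d. zs ! k ^ j * v $ j)"
        by (simp add: p_def poly_sum poly_monom k(2) mult.commute)
      also have "\<dots> = (V *\<^sub>v v) $ k"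
        using k(1) v(1) by (simp add: V_def scalar_prod_def atLeast0LessThan)
      finally show ?thesis using v(3) k(1) by simp
    qed
    then have "Z \<subseteq> {z. poly p z = 0}" by blast
    then have "card Z \<le> card {z. poly p z = 0}"
      by (rule card_mono[OF poly_roots_finite[OF \<open>p \<noteq> 0\<close>]])
    also have "\<dots> \<le> degree p" by (rule card_poly_roots_bound[OF \<open>p \<noteq> 0\<close>])
    finally have "card Z \<le> degree p" .
    with \<open>degree p < d\<close> Z(2) show False by (simp add: d_def)
  qed
  ultimately have "det D = of_int (det M)" by simp
  moreover have "det D = (\<Prod>z\<in>Z. poly (map_poly of_int q) z)"
  proof -
    have "det D = prod_list (diag_mat D)"
      by (rule det_upper_triangular[OF _ car(3)]) (auto simp: D_def)
    also have "diag_mat D = map (\<lambda>z. poly (map_poly of_int q) z) zs"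
      by (rule nth_equalityI) (auto simp: diag_mat_def D_def len)
    also have "prod_list \<dots> = (\<Prod>z\<in>Z. poly (map_poly of_int q) z)"
      using zs(2) by (simp add: prod.distinct_set_conv_list flip: zs(1))
    finally show ?thesis .
  qed
  ultimately show ?thesis by simp
qed

section \<open>Gauss's lemma and minimal polynomials\<close>

lemma rat_poly_common_denominator:
  fixes f :: "rat poly"
  shows "\<exists>D F. D > 0 \<and> Polynomial.smult (of_int D) f = of_int_poly F"
proof (induction f)
  case 0
  then show ?case by (intro exI[of _ 1] exI[of _ 0]) simp
next
  case (pCons a f)
  then obtain D F where DF: "D > 0" "Polynomial.smult (of_int D) f = of_int_poly F" by blast
  obtain n d where a: "a = of_int n / of_int d" "d > 0"
    by (metis quotient_of_denom_pos quotient_of_div surj_pair)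
  have "Polynomial.smult (of_int (d * D)) (pCons a f) = pCons (of_int (n * D)) (Polynomial.smult (of_int d) (Polynomial.smult (of_int D) f))"
    using a by (simp add: mult_ac)
  also have "\<dots> = of_int_poly (pCons (n * D) (Polynomial.smult d F))"
    unfolding DF(2) by (simp add: poly_eq_iff coeff_map_poly coeff_pCons split: nat.split)
  finally show ?case using a(2) DF(1) by (intro exI[of _ "d * D"] exI[of _ "pCons (n * D) (Polynomial.smult d F)"]) simp
qed

lemma of_int_poly_inj: "(of_int_poly p :: 'a :: ring_char_0 poly) = of_int_poly q \<longleftrightarrow> p = q"
  by (simp add: poly_eq_iff coeff_map_poly)

text \<open>Gauss's lemma. Once denominators are cleared, the leading coefficients are
  \<open>D\<close> and \<open>E\<close>, so the contents of \<open>F\<close> and \<open>G\<close>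
  divide them. By multiplicativity the product of the contents is \<open>D * E\<close>, so
  \<open>content F = D\<close> and \<open>D\<close> cancels.\<close>

lemma monic_factor_of_int_poly:
  fixes \<mu> \<nu> :: "rat poly" and p :: "int poly"
  assumes eq: "of_int_poly p = \<mu> * \<nu>" and p: "lead_coeff p = 1" and \<mu>: "lead_coeff \<mu> = 1"
  shows "\<exists>m :: int poly. \<mu> = of_int_poly m"
proof -
  have "lead_coeff (of_int_poly p :: rat poly) = 1" using p by simp
  then have \<nu>: "lead_coeff \<nu> = 1" using \<mu> by (simp add: eq lead_coeff_mult)
  obtain D F where DF: "D > 0" "Polynomial.smult (of_int D) \<mu> = of_int_poly F"
    using rat_poly_common_denominator by blast
  obtain E G where EG: "E > 0" "Polynomial.smult (of_int E) \<nu> = of_int_poly G"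
    using rat_poly_common_denominator by blast
  have "of_int_poly (Polynomial.smult (D * E) p) = Polynomial.smult (of_int D) \<mu> * Polynomial.smult (of_int E) \<nu>"
    by (simp add: of_int_hom.map_poly_hom_smult eq mult_ac)
  also have "\<dots> = of_int_poly (F * G)" by (simp add: DF EG of_int_poly_hom.hom_mult)
  finally have prod: "Polynomial.smult (D * E) p = F * G" by (simp only: of_int_poly_inj)
  have "content p dvd 1" using content_dvd_coeff[of p "degree p"] p by simp
  then have "content p = 1" by (simp only: is_unit_content_iff)
  then have "content (F * G) = D * E"
    using DF(1) EG(1) by (simp flip: prod)
  then have cont: "content F * content G = D * E" by (simp only: content_mult)
  have "of_int (lead_coeff F) = lead_coeff (Polynomial.smult (of_int D) \<mu>)"
    "of_int (lead_coeff G) = lead_coeff (Polynomial.smult (of_int E) \<nu>)"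
    by (simp_all only: DF(2) EG(2), simp_all)
  then have "of_int (lead_coeff F) = (of_int D :: rat)" "of_int (lead_coeff G) = (of_int E :: rat)"
    using \<mu> \<nu> by (simp_all only: lead_coeff_smult mult_1_right)
  then have "lead_coeff F = D" "lead_coeff G = E" by (simp_all only: of_int_eq_iff)
  then have "content F dvd D" "content G dvd E"
    using content_dvd_coeff[of F "degree F"] content_dvd_coeff[of G "degree G"] by auto
  then obtain x y where xy: "D = content F * x" "E = content G * y" by (auto elim!: dvdE)
  with cont DF(1) EG(1) have "x * y = 1" by auto
  moreover have "content F \<ge> 0" using normalize_content[of F] by (metis abs_ge_zero normalize_int_def)
  with xy(1) DF(1) have "x > 0" by (simp add: zero_less_mult_iff)
  ultimately have "x = 1" using zmult_eq_1_iff[of x y] by auto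
  then have "F = Polynomial.smult D (primitive_part F)" using xy(1) by simp
  then have "Polynomial.smult (of_int D) \<mu> = Polynomial.smult (of_int D) (of_int_poly (primitive_part F))"
    using DF(2) by (metis of_int_hom.map_poly_hom_smult)
  then have "\<mu> = of_int_poly (primitive_part F)"
    using DF(1) smult_cancel[of "of_int D" \<mu>] by simp
  then show ?thesis by blast
qed

lemma of_rat_of_int_poly [simp]:
  "map_poly of_rat (of_int_poly p) = (of_int_poly p :: 'a :: field_char_0 poly)"
  by (simp add: poly_eq_iff coeff_map_poly)

lemma of_rat_poly_mult:
  "map_poly of_rat (p * q) = (map_poly of_rat p * map_poly of_rat q :: 'a :: field_char_0 poly)"
proof -
  interpret map_poly_comm_ring_hom "of_rat :: rat \<Rightarrow> 'a" ..
  show ?thesis by (rule hom_mult)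
qed

lemma of_rat_poly_add:
  "map_poly of_rat (p + q) = (map_poly of_rat p + map_poly of_rat q :: 'a :: field_char_0 poly)"
proof -
  interpret map_poly_comm_ring_hom "of_rat :: rat \<Rightarrow> 'a" ..
  show ?thesis by (rule hom_add)
qed

text \<open>Otherwise a Bezout identity \<open>a * \<mu> + b * f = 1\<close>, evaluated at
  \<open>z\<close>, gives \<open>0 = 1\<close>.\<close>

lemma irreducible_dvd_of_common_root:
  fixes \<mu> f :: "rat poly" and z :: "'a :: field_char_0"
  assumes \<mu>: "irreducible \<mu>" and z: "poly (map_poly of_rat \<mu>) z = 0" "poly (map_poly of_rat f) z = 0"
  shows "\<mu> dvd f"
proof (rule ccontr)
  assume "\<not> \<mu> dvd f"
  then have "Rings.coprime \<mu> f"
    using \<mu> by (meson prime_elem_imp_coprime irreducible_imp_prime_elem)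
  then obtain a b where "a * \<mu> + b * f = 1"
    by (metis bezout_coefficients_fst_snd coprime_imp_gcd_eq_1)
  then have "poly (map_poly of_rat (a * \<mu> + b * f)) z = 1" by simp
  with z show False by (simp add: of_rat_poly_add of_rat_poly_mult)
qed

text \<open>A monic annihilating polynomial of least degree is irreducible. It divides the monic
  integer polynomial that has \<open>x\<close> as a root, so Gauss's lemma gives integer
  coefficients.\<close>

lemma minimal_poly_exists:
  fixes x :: real
  assumes "algebraic_int x"
  obtains m :: "int poly" where "is_minimal_poly (of_int_poly m) x" "lead_coeff m = 1"
proof -
  obtain p :: "int poly" where p: "poly (of_int_poly p) x = 0" "lead_coeff p = 1"
    using assms by (auto simp: algebraic_int_altdef_ipoly)
  define P where "P = (\<lambda>f :: rat poly. lead_coeff f = 1 \<and> poly (map_poly of_rat f) x = 0)"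
  have "P (of_int_poly p)" using p by (simp add: P_def)
  then obtain \<mu> where \<mu>: "P \<mu>" and least: "\<And>f. P f \<Longrightarrow> degree \<mu> \<le> degree f"
    using ex_has_least_nat[of P _ degree] by blast
  have small: "degree \<mu> \<le> degree f" if "f \<noteq> 0" "poly (map_poly of_rat f) x = 0" for f :: "rat poly"
  proof -
    have "P (Polynomial.smult (1 / lead_coeff f) f)"
      using that by (simp add: P_def of_rat_hom.map_poly_hom_smult)
    from least[OF this] that(1) show ?thesis by simp
  qed
  have "\<mu> \<noteq> 0" using \<mu> by (auto simp: P_def)
  have "irreducible \<mu>"
  proof (rule irreducibleI)
    show "\<not> is_unit \<mu>"
    proof
      assume "is_unit \<mu>"
      then have "degree \<mu> = 0" using \<open>\<mu> \<noteq> 0\<close> is_unit_iff_degree by blast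
      then obtain c where "\<mu> = [:c:]" by (rule degree_eq_zeroE)
      with \<mu> have "\<mu> = 1" by (simp add: P_def one_pCons)
      with \<mu> show False by (simp add: P_def)
    qed
    fix a b assume ab: "\<mu> = a * b"
    then have nz: "a \<noteq> 0" "b \<noteq> 0" using \<open>\<mu> \<noteq> 0\<close> by auto
    then have deg: "degree \<mu> = degree a + degree b" by (simp add: ab degree_mult_eq)
    have "poly (map_poly of_rat a) x = 0 \<or> poly (map_poly of_rat b) x = 0"
      using \<mu> by (simp add: P_def ab of_rat_poly_mult)
    then have "degree a = 0 \<or> degree b = 0" using small[OF nz(1)] small[OF nz(2)] deg by auto
    then show "is_unit a \<or> is_unit b" using nz is_unit_iff_degree by blast
  qed fact
  then have min: "is_minimal_poly \<mu> x" using \<mu> by (simp add: is_minimal_poly_def P_def)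
  have "\<mu> dvd of_int_poly p"
    using irreducible_dvd_of_common_root[OF \<open>irreducible \<mu>\<close>, of x "of_int_poly p"] \<mu> p by (simp add: P_def)
  then obtain \<nu> where "of_int_poly p = \<mu> * \<nu>" by (elim dvdE)
  then obtain m where m: "\<mu> = of_int_poly m"
    using monic_factor_of_int_poly[of p \<mu> \<nu>] p \<mu> by (auto simp: P_def)
  moreover have "lead_coeff m = 1" using \<mu> by (simp add: P_def m)
  ultimately show ?thesis using that min by blast
qed

lemma minimal_poly_unique:
  assumes "is_minimal_poly p x" "is_minimal_poly q x"
  shows "p = q"
proof -
  have "p dvd q" "q dvd p"
    using assms irreducible_dvd_of_common_root[of p x q] irreducible_dvd_of_common_root[of q x p]
    by (auto simp: is_minimal_poly_def)
  then show ?thesis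
    using assms by (intro poly_dvd_antisym) (auto simp: is_minimal_poly_def)
qed

text \<open>The product is the absolute value of the norm of \<open>q(x)\<close>, a nonzero integer.\<close>

lemma norm_conjugates_ge_1:
  fixes x :: real and q :: "int poly"
  assumes "algebraic_int x" "poly (of_int_poly q) x \<noteq> 0"
  shows "finite (galois_conjugates x)" "of_real x \<in> galois_conjugates x"
    "1 \<le> (\<Prod>z\<in>galois_conjugates x. norm (poly (of_int_poly q) z))"
proof -
  obtain m :: "int poly" where m: "is_minimal_poly (of_int_poly m) x" "lead_coeff m = 1"
    using minimal_poly_exists[OF assms(1)] by blast
  define Z where "Z = {z :: complex. poly (of_int_poly m) z = 0}"
  have conj: "galois_conjugates x = Z"
  proof -
    have "is_minimal_poly p x \<longleftrightarrow> p = of_int_poly m" for p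
      using m(1) minimal_poly_unique[OF m(1)] by blast
    then show ?thesis by (simp add: galois_conjugates_def Z_def)
  qed
  have irr: "irreducible (of_int_poly m :: rat poly)" using m(1) by (simp add: is_minimal_poly_def)
  have nz: "(of_int_poly m :: complex poly) \<noteq> 0" using m(2) by auto
  have of_real_poly: "poly (of_int_poly f) (complex_of_real x) = of_real (poly (of_int_poly f) x)"
    for f :: "int poly"
    by (simp add: poly_altdef)
  show fin: "finite (galois_conjugates x)"
    unfolding conj Z_def by (rule poly_roots_finite[OF nz])
  show "of_real x \<in> galois_conjugates x"
    using m(1) by (simp add: conj Z_def is_minimal_poly_def of_real_poly)
  \<comment> \<open>Separability: a common root would make the irreducible \<open>m\<close> divide
    its derivative, which is nonzero and of smaller degree.\<close>
  have sep: "\<not> (poly (of_int_poly m) z = 0 \<and> poly (pderiv (of_int_poly m)) z = 0)" for z :: complex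
  proof
    assume z: "poly (of_int_poly m) z = 0 \<and> poly (pderiv (of_int_poly m)) z = 0"
    have "degree (of_int_poly m :: rat poly) \<noteq> 0"
      using irr by (metis irreducible_def is_unit_iff_degree)
    then have deg: "degree m \<noteq> 0" by simp
    have "map_poly of_rat (pderiv (of_int_poly m)) = (pderiv (of_int_poly m) :: complex poly)"
      by (simp add: poly_eq_iff coeff_map_poly coeff_pderiv of_rat_mult of_rat_add)
    then have "(of_int_poly m :: rat poly) dvd pderiv (of_int_poly m)"
      using irreducible_dvd_of_common_root[OF irr, of z "pderiv (of_int_poly m)"] z by simp
    moreover have "pderiv (of_int_poly m :: rat poly) \<noteq> 0" using deg by (simp add: pderiv_eq_0_iff)
    ultimately have "degree (of_int_poly m :: rat poly) \<le> degree (pderiv (of_int_poly m :: rat poly))"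
      by (rule dvd_imp_degree_le)
    then show False using deg by (simp add: degree_pderiv)
  qed
  then have "card Z = degree m"
    using rsquarefree_card_degree[OF nz] by (simp add: rsquarefree_roots Z_def)
  then have int: "(\<Prod>z\<in>Z. poly (of_int_poly q) z) \<in> \<int>"
    using fin by (intro prod_roots_int_poly[OF m(2)]) (auto simp: conj Z_def)
  \<comment> \<open>If \<open>q\<close> vanishes at one conjugate, then \<open>m\<close> divides
    \<open>q\<close>, and \<open>q\<close> vanishes at \<open>x\<close> too.\<close>
  have "poly (of_int_poly q) z \<noteq> 0" if "z \<in> Z" for z
  proof
    assume "poly (of_int_poly q) z = 0"
    then have "(of_int_poly m :: rat poly) dvd of_int_poly q"
      using irreducible_dvd_of_common_root[OF irr, of z "of_int_poly q"] that by (simp add: Z_def)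
    then obtain f :: "rat poly" where f: "of_int_poly q = of_int_poly m * f" by (elim dvdE)
    have "poly (map_poly of_rat (of_int_poly q :: rat poly)) x = 0"
      using m(1) unfolding f by (simp add: of_rat_poly_mult is_minimal_poly_def)
    with assms(2) show False by simp
  qed
  then have nz': "(\<Prod>z\<in>Z. poly (of_int_poly q) z) \<noteq> 0" using fin by (simp add: conj)
  obtain n where n: "(\<Prod>z\<in>Z. poly (of_int_poly q) z) = of_int n" using int by (elim Ints_cases)
  with nz' have "n \<noteq> 0" by auto
  then have "1 \<le> norm (of_int n :: complex)" by simp
  then show "1 \<le> (\<Prod>z\<in>galois_conjugates x. norm (poly (of_int_poly q) z))"
    by (simp add: conj prod_norm flip: n)
qed

subsection \<open>Tails of the series\<close>

text \<open>These fractions form a subfield containing \<open>x\<close>, hence contain the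
  hull.\<close>

lemma rat_adjoin_fraction:
  assumes "y \<in> rat_adjoin x"
  shows "\<exists>p q :: int poly. poly (of_int_poly q) x \<noteq> 0 \<and> y = poly (of_int_poly p) x / poly (of_int_poly q) x"
proof -
  define F where "F = {y. \<exists>p q :: int poly. poly (of_int_poly q) x \<noteq> 0 \<and>
    y = poly (of_int_poly p) x / poly (of_int_poly q) x}"
  have F: "poly (of_int_poly p) x / poly (of_int_poly q) x \<in> F" if "poly (of_int_poly q) x \<noteq> 0"
    for p q :: "int poly"
    using that unfolding F_def by blast
  have "is_subfield F"
    unfolding is_subfield_def
  proof (intro conjI ballI)
    show "0 \<in> F" "1 \<in> F" using F[of 1 0] F[of 1 1] by simp_all
    fix y assume "y \<in> F"
    then obtain p q :: "int poly" where y: "poly (of_int_poly q) x \<noteq> 0"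
      "y = poly (of_int_poly p) x / poly (of_int_poly q) x" unfolding F_def by blast
    show "- y \<in> F" using F[OF y(1), of "- p"] by (simp add: y(2) of_int_poly_hom.hom_uminus)
    \<comment> \<open>A vanishing numerator is covered by the convention
      \<open>inverse 0 = 0\<close>.\<close>
    show "inverse y \<in> F"
      using F[of p q] F[of 1 0] y by (cases "poly (of_int_poly p) x = 0") auto
    fix z assume "z \<in> F"
    then obtain r s :: "int poly" where z: "poly (of_int_poly s) x \<noteq> 0"
      "z = poly (of_int_poly r) x / poly (of_int_poly s) x" unfolding F_def by blast
    show "y + z \<in> F" using F[of "q * s" "p * s + r * q"] y z
      by (simp add: of_int_poly_hom.hom_mult of_int_poly_hom.hom_add add_frac_eq)
    show "y * z \<in> F" using F[of "q * s" "p * r"] y z by (simp add: of_int_poly_hom.hom_mult)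
  qed
  moreover have "x \<in> F" using F[of 1 "[:0, 1:]"] by (simp add: map_poly_pCons)
  ultimately have "rat_adjoin x \<subseteq> F" unfolding rat_adjoin_def by (intro hull_minimal) auto
  with assms show ?thesis unfolding F_def by blast
qed

lemma rat_adjoin_common_denominator:
  assumes "finite I" "\<And>i. i \<in> I \<Longrightarrow> c i \<in> rat_adjoin x"
  shows "\<exists>(A :: 'i \<Rightarrow> int poly) R. poly (of_int_poly R) x \<noteq> 0 \<and>
    (\<forall>i\<in>I. c i * poly (of_int_poly R) x = poly (of_int_poly (A i)) x)"
proof -
  obtain p q :: "'i \<Rightarrow> int poly" where
    pq: "\<And>i. i \<in> I \<Longrightarrow> poly (of_int_poly (q i)) x \<noteq> 0"
      "\<And>i. i \<in> I \<Longrightarrow> c i = poly (of_int_poly (p i)) x / poly (of_int_poly (q i)) x"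
    using rat_adjoin_fraction[OF assms(2)] by metis
  define R where "R = (\<Prod>i\<in>I. q i)"
  have R: "poly (of_int_poly R) x = (\<Prod>i\<in>I. poly (of_int_poly (q i)) x)"
    by (simp add: R_def of_int_poly_hom.hom_prod poly_prod)
  show ?thesis
  proof (intro exI conjI ballI)
    show "poly (of_int_poly R) x \<noteq> 0" using pq(1) assms(1) by (simp add: R)
    fix i assume i: "i \<in> I"
    then have "R = q i * (\<Prod>j\<in>I - {i}. q j)"
      unfolding R_def using assms(1) by (rule_tac prod.remove)
    then show "c i * poly (of_int_poly R) x = poly (of_int_poly (p i * (\<Prod>j\<in>I - {i}. q j))) x"
      using pq[OF i] by (simp add: of_int_poly_hom.hom_mult)
  qed
qed

lemma suminf_split_geometric:
  fixes w :: "nat \<Rightarrow> real" and x :: real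
  assumes x: "x > 1" and w: "\<And>n. \<bar>w n\<bar> \<le> B"
  shows "summable (\<lambda>n. w n / x ^ Suc n)"
    and "\<bar>(\<Sum>n. w n / x ^ Suc n) - (\<Sum>n<J. w n / x ^ Suc n)\<bar> \<le> B / (x ^ J * (x - 1))"
proof -
  have geo: "(\<lambda>n. B / x ^ J * (1 / x) ^ Suc n) sums (B / (x ^ J * (x - 1)))" for J
  proof -
    have "(\<lambda>n. (1 / x) ^ n) sums (1 / (1 - 1 / x))" using x by (intro geometric_sums) simp
    then have "(\<lambda>n. (B / x ^ J * (1 / x)) * (1 / x) ^ n) sums ((B / x ^ J * (1 / x)) * (1 / (1 - 1 / x)))"
      by (rule sums_mult)
    moreover have "(B / x ^ J * (1 / x)) * (1 / (1 - 1 / x)) = B / (x ^ J * (x - 1))"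
      using x by (simp add: divide_simps)
    ultimately have "(\<lambda>n. (B / x ^ J * (1 / x)) * (1 / x) ^ n) sums (B / (x ^ J * (x - 1)))"
      by (simp only:)
    then show ?thesis by (simp only: power_Suc mult.assoc)
  qed
  have bd: "\<bar>w (n + J) / x ^ Suc (n + J)\<bar> \<le> B / x ^ J * (1 / x) ^ Suc n" for n J
  proof -
    have "\<bar>w (n + J) / x ^ Suc (n + J)\<bar> = \<bar>w (n + J)\<bar> / x ^ Suc (n + J)" using x by simp
    also have "\<dots> \<le> B / x ^ Suc (n + J)" using x w by (intro divide_right_mono) auto
    finally show ?thesis by (simp add: power_add power_divide mult_ac)
  qed
  show sm: "summable (\<lambda>n. w n / x ^ Suc n)"
  proof (rule summable_comparison_test')
    show "summable (\<lambda>n. B / x ^ 0 * (1 / x) ^ Suc n)" using geo[of 0] by (rule sums_summable)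
    show "norm (w n / x ^ Suc n) \<le> B / x ^ 0 * (1 / x) ^ Suc n" for n
      using bd[of n 0] by simp
  qed
  have "(\<Sum>n. w n / x ^ Suc n) - (\<Sum>n<J. w n / x ^ Suc n) = (\<Sum>n. w (n + J) / x ^ Suc (n + J))"
    using suminf_split_initial_segment[OF sm, of J] by simp
  also have "\<bar>\<dots>\<bar> \<le> (\<Sum>n. B / x ^ J * (1 / x) ^ Suc n)"
    unfolding real_norm_def[symmetric]
    by (rule norm_suminf_le) (use bd geo[of J] in \<open>auto simp: sums_iff\<close>)
  also have "\<dots> = B / (x ^ J * (x - 1))" using geo[of J] by (simp add: sums_iff)
  finally show "\<bar>(\<Sum>n. w n / x ^ Suc n) - (\<Sum>n<J. w n / x ^ Suc n)\<bar> \<le> B / (x ^ J * (x - 1))" .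
qed

text \<open>
  If the series vanishes, its tails are values at \<open>\<beta>\<close> of integer polynomials \<open>Q N\<close> whose
  conjugates grow at most linearly in \<open>N\<close>; hence a nonzero difference of two tails is not too small.
\<close>

lemma tail_difference_lower_bound:
  fixes \<beta> :: real and A :: "int poly" and U :: "nat \<Rightarrow> int poly"
  assumes alg: "algebraic_int \<beta>" and \<beta>: "\<beta> > 1"
    and conj: "\<And>z. z \<in> galois_conjugates \<beta> - {of_real \<beta>} \<Longrightarrow> norm z \<le> 1"
    and U: "finite (range U)"
    and rel: "poly (of_int_poly A) \<beta> + (\<Sum>n. poly (of_int_poly (U (Suc n))) \<beta> / \<beta> ^ Suc n) = 0"
  defines "V \<equiv> \<lambda>N N'. \<Sum>n. (poly (of_int_poly (U (N + Suc n))) \<beta>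
    - poly (of_int_poly (U (N' + Suc n))) \<beta>) / \<beta> ^ Suc n"
  shows "\<exists>C D. C > 0 \<and> (\<forall>N N' M. N \<le> M \<longrightarrow> N' \<le> M \<longrightarrow> V N N' \<noteq> 0 \<longrightarrow> 1 \<le> \<bar>V N N'\<bar> * (C * (real M + 1) ^ D))"
proof -
  define u where "u n = poly (of_int_poly (U n)) \<beta>" for n
  \<comment> \<open>Horner's scheme: \<open>Q N\<close> is \<open>x ^ N\<close> times the relation
    truncated after index \<open>N\<close>. As the whole series cancels, its value at
    \<open>\<beta>\<close> is minus the scaled tail, so the tails lie in
    \<open>\<int>[\<beta>]\<close>.\<close>
  define Q where "Q = rec_nat A (\<lambda>n q. pCons 0 q + U (Suc n))"
  have Q: "Q 0 = A" "Q (Suc n) = pCons 0 (Q n) + U (Suc n)" for n by (simp_all add: Q_def)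
  have "\<exists>B. \<forall>n. norm (poly (of_int_poly (U n)) z) \<le> B" for z :: "'a :: {real_normed_field}"
  proof -
    have "finite (range (\<lambda>n. norm (poly (of_int_poly (U n)) z)))"
      using finite_imageI[OF U, of "\<lambda>q. norm (poly (of_int_poly q) z)"] by (simp add: image_image)
    then show ?thesis by (meson Max_ge rangeI)
  qed
  note bdd = this
  obtain B where B: "\<And>n. \<bar>u n\<bar> \<le> B" using bdd[of \<beta>] by (auto simp: u_def)
  have sm: "summable (\<lambda>n. u (N + Suc n) / \<beta> ^ Suc n)" for N
    by (rule suminf_split_geometric[OF \<beta> B])
  have Q_eval: "poly (of_int_poly (Q N)) \<beta> = - (\<Sum>n. u (N + Suc n) / \<beta> ^ Suc n)" for N
  proof (induction N)
    case 0
    then show ?case using rel by (simp add: Q u_def)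
  next
    case (Suc N)
    have "(\<Sum>n. u (N + Suc n) / \<beta> ^ Suc n) = (\<Sum>n. u (N + Suc (Suc n)) / \<beta> ^ Suc (Suc n)) + u (N + Suc 0) / \<beta> ^ Suc 0"
      using suminf_split_head[OF sm[of N]] by simp
    moreover have "(\<Sum>n. u (N + Suc (Suc n)) / \<beta> ^ Suc (Suc n)) = (\<Sum>n. u (Suc N + Suc n) / \<beta> ^ Suc n) / \<beta>"
      by (subst suminf_divide[OF sm[of "Suc N"], symmetric]) (simp add: mult_ac)
    ultimately have "\<beta> * (\<Sum>n. u (N + Suc n) / \<beta> ^ Suc n) = (\<Sum>n. u (Suc N + Suc n) / \<beta> ^ Suc n) + u (Suc N)"
      using \<beta> by (simp add: distrib_left)
    moreover have "poly (of_int_poly (Q (Suc N))) \<beta> = \<beta> * poly (of_int_poly (Q N)) \<beta> + u (Suc N)"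
      by (simp add: Q of_int_poly_hom.hom_add of_int_hom.map_poly_pCons_hom u_def)
    ultimately show ?case by (simp only: Suc)
  qed
  have V: "V N N' = poly (of_int_poly (Q N' - Q N)) \<beta>" for N N'
  proof -
    have "V N N' = (\<Sum>n. u (N + Suc n) / \<beta> ^ Suc n - u (N' + Suc n) / \<beta> ^ Suc n)"
      by (simp only: V_def u_def diff_divide_distrib)
    also have "\<dots> = (\<Sum>n. u (N + Suc n) / \<beta> ^ Suc n) - (\<Sum>n. u (N' + Suc n) / \<beta> ^ Suc n)"
      by (rule suminf_diff[OF sm sm, symmetric])
    also have "\<dots> = poly (of_int_poly (Q N')) \<beta> - poly (of_int_poly (Q N)) \<beta>"
      by (simp only: Q_eval)
    also have "\<dots> = poly (of_int_poly (Q N' - Q N)) \<beta>"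
      by (simp only: of_int_poly_hom.hom_minus poly_diff)
    finally show ?thesis .
  qed
  define Z where "Z = galois_conjugates \<beta> - {of_real \<beta>}"
  \<comment> \<open>As \<open>norm z \<le> 1\<close>, each Horner step adds at most a constant to
    the norm.\<close>
  have "\<forall>z. \<exists>B>0. \<forall>N. z \<in> Z \<longrightarrow> norm (poly (of_int_poly (Q N)) z) \<le> B * (real N + 1)"
  proof
    fix z :: complex
    obtain b where b: "\<And>n. norm (poly (of_int_poly (U n)) z) \<le> b" using bdd[of z] by auto
    define c where "c = max 1 (max b (norm (poly (of_int_poly A) z)))"
    have "norm (poly (of_int_poly (Q N)) z) \<le> c * (real N + 1)" if "z \<in> Z" for N
    proof (induction N)
      case 0
      then show ?case by (simp add: Q c_def)
    next
      case (Suc N)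
      have "norm (poly (of_int_poly (Q (Suc N))) z) \<le>
          norm z * norm (poly (of_int_poly (Q N)) z) + norm (poly (of_int_poly (U (Suc N))) z)"
        using norm_triangle_ineq[of "z * poly (of_int_poly (Q N)) z" "poly (of_int_poly (U (Suc N))) z"]
        by (simp add: Q of_int_poly_hom.hom_add of_int_hom.map_poly_pCons_hom norm_mult)
      also have "\<dots> \<le> 1 * (c * (real N + 1)) + c"
        using conj[OF that[unfolded Z_def]] b[of "Suc N"] Suc
        by (intro add_mono mult_mono) (auto simp: c_def)
      finally show ?case by (simp add: algebra_simps)
    qed
    moreover have "c > 0" by (simp add: c_def)
    ultimately show "\<exists>B>0. \<forall>N. z \<in> Z \<longrightarrow> norm (poly (of_int_poly (Q N)) z) \<le> B * (real N + 1)" by blast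
  qed
  then obtain c where c: "\<And>z. c z > 0"
    "\<And>z N. z \<in> Z \<Longrightarrow> norm (poly (of_int_poly (Q N)) z) \<le> c z * (real N + 1)" by metis
  show ?thesis
  proof (rule exI[of _ "\<Prod>z\<in>Z. 2 * c z"], rule exI[of _ "card Z"], intro conjI allI impI)
    show "(\<Prod>z\<in>Z. 2 * c z) > 0" using c(1) by (simp add: prod_pos)
    fix N N' M assume le: "N \<le> M" "N' \<le> M" and V0: "V N N' \<noteq> 0"
    define q where "q = Q N' - Q N"
    note norm = norm_conjugates_ge_1[OF alg V0[unfolded V, folded q_def]]
    \<comment> \<open>The factor at \<open>\<beta>\<close> is the absolute value of
      \<open>V N N'\<close>. Each of the remaining \<open>card Z\<close> factors is linear in
      \<open>M\<close>, which explains the exponent.\<close>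
    have "1 \<le> (\<Prod>z\<in>galois_conjugates \<beta>. norm (poly (of_int_poly q) z))" by (rule norm(3))
    also have "\<dots> = norm (poly (of_int_poly q) (complex_of_real \<beta>)) * (\<Prod>z\<in>Z. norm (poly (of_int_poly q) z))"
      unfolding Z_def by (rule prod.remove[OF norm(1,2)])
    also have "poly (of_int_poly q) (complex_of_real \<beta>) = of_real (poly (of_int_poly q) \<beta>)"
      by (simp add: poly_altdef)
    also have "norm \<dots> = \<bar>V N N'\<bar>" by (simp add: V q_def)
    also have "\<bar>V N N'\<bar> * (\<Prod>z\<in>Z. norm (poly (of_int_poly q) z)) \<le> \<bar>V N N'\<bar> * (\<Prod>z\<in>Z. 2 * c z * (real M + 1))"
    proof (intro mult_left_mono prod_mono conjI)
      fix z assume z: "z \<in> Z"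
      have "norm (poly (of_int_poly q) z) \<le> norm (poly (of_int_poly (Q N')) z) + norm (poly (of_int_poly (Q N)) z)"
        by (simp add: q_def of_int_poly_hom.hom_minus norm_triangle_ineq4)
      also have "\<dots> \<le> c z * (real N' + 1) + c z * (real N + 1)" by (intro add_mono c(2)[OF z])
      also have "\<dots> \<le> c z * (real M + 1) + c z * (real M + 1)"
        using le c(1)[of z] by (intro add_mono mult_left_mono) auto
      finally show "norm (poly (of_int_poly q) z) \<le> 2 * c z * (real M + 1)" by simp
    qed auto
    also have "(\<Prod>z\<in>Z. 2 * c z * (real M + 1)) = (\<Prod>z\<in>Z. 2 * c z) * (real M + 1) ^ card Z"
      by (simp only: prod.distrib prod_constant)
    finally show "1 \<le> \<bar>V N N'\<bar> * ((\<Prod>z\<in>Z. 2 * c z) * (real M + 1) ^ card Z)" .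
  qed
qed

text \<open>Choose \<open>L\<close> with \<open>x ^ L\<close> above twice \<open>C\<close>; then
  \<open>x ^ (L * b)\<close> already beats \<open>M * C ^ b\<close>, one factor \<open>2 ^ b\<close>
  absorbing \<open>M\<close>, and \<open>L * b \<le> 2 ^ b\<close> for large
  \<open>b\<close>.\<close>

lemma double_exponential_growth:
  fixes x C M :: real
  assumes x: "x > 1"
  shows "eventually (\<lambda>b. M * C ^ b < x ^ (2 ^ b)) sequentially"
proof -
  obtain L where L: "2 * max 1 \<bar>C\<bar> < x ^ L" using real_arch_pow[OF x] by blast
  have "(\<lambda>b. real b / 2 ^ b) \<longlonglongrightarrow> 0"
    using lim_n_over_pown[of "2 :: real"] by simp
  then have "eventually (\<lambda>b. real b / 2 ^ b < 1 / (real L + 1)) sequentially"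
    by (rule order_tendstoD) simp
  moreover have "eventually (\<lambda>b. b \<ge> nat \<lceil>\<bar>M\<bar>\<rceil>) sequentially" by (rule eventually_ge_at_top)
  ultimately show ?thesis
  proof eventually_elim
    case (elim b)
    have "\<bar>M\<bar> \<le> real b" using elim(2) by linarith
    also have "\<dots> < 2 ^ b" by (rule of_nat_less_two_power)
    finally have M: "\<bar>M\<bar> < 2 ^ b" .
    have "real b * (real L + 1) < 2 ^ b" using elim(1) by (simp add: field_simps)
    then have "real (L * b) \<le> real (2 ^ b)" by (simp add: algebra_simps)
    then have Lb: "L * b \<le> 2 ^ b" by (simp only: of_nat_le_iff)
    have "M * C ^ b \<le> \<bar>M\<bar> * \<bar>C\<bar> ^ b" by (metis abs_ge_self abs_mult power_abs)
    also have "\<dots> \<le> \<bar>M\<bar> * max 1 \<bar>C\<bar> ^ b" by (intro mult_left_mono power_mono) auto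
    also have "\<dots> < 2 ^ b * max 1 \<bar>C\<bar> ^ b" using M by (intro mult_strict_right_mono) (auto intro: zero_less_power)
    also have "\<dots> = (2 * max 1 \<bar>C\<bar>) ^ b" by (simp only: power_mult_distrib)
    also have "\<dots> \<le> (x ^ L) ^ b" using L by (intro power_mono) auto
    also have "\<dots> = x ^ (L * b)" by (simp only: power_mult)
    also have "\<dots> \<le> x ^ (2 ^ b)" using Lb x by (intro power_increasing) auto
    finally show ?case .
  qed
qed

section \<open>Pairs of close but distinct tails\<close>

definition weighted_thue_morse :: "(nat \<Rightarrow> real) \<Rightarrow> nat \<Rightarrow> nat \<Rightarrow> real" where
  "weighted_thue_morse a K n = (\<Sum>k=1..K. a k * real (thue_morse (n ^ k)))"

lemma weighted_thue_morse_bound: "\<bar>weighted_thue_morse a K n\<bar> \<le> (\<Sum>k=1..K. \<bar>a k\<bar>)"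
  unfolding weighted_thue_morse_def
  by (rule order_trans[OF sum_abs sum_mono]) (auto simp: abs_mult thue_morse_def)

lemma weighted_thue_morse_diff_bound:
  "\<bar>weighted_thue_morse a K m - weighted_thue_morse a K n\<bar> \<le> 2 * (\<Sum>k=1..K. \<bar>a k\<bar>)"
  using weighted_thue_morse_bound[of a K m] weighted_thue_morse_bound[of a K n] by linarith

lemma sum_lessThan_add:
  fixes f :: "nat \<Rightarrow> 'a :: comm_monoid_add"
  shows "(\<Sum>i<m + n. f i) = (\<Sum>i<m. f i) + (\<Sum>i<n. f (i + m))"
  by (induction n) (simp_all add: add.assoc add.commute[of m])

text \<open>Splitting off the top binary digit of \<open>i\<close> changes the sign and contributes
  \<open>y ^ (2 ^ b)\<close>.\<close>

lemma thue_morse_product: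
  fixes y :: real
  shows "(\<Sum>i<2 ^ b. (- 1) ^ s2 i * y ^ i) = (\<Prod>l<b. 1 - y ^ (2 ^ l))"
proof (induction b)
  case (Suc b)
  have "(\<Sum>i<2 ^ Suc b. (- 1) ^ s2 i * y ^ i) = (\<Sum>i<2 ^ b + 2 ^ b. (- 1) ^ s2 i * y ^ i)"
    by (simp add: mult_2)
  also have "\<dots> = (\<Sum>i<2 ^ b. (- 1) ^ s2 i * y ^ i) + (\<Sum>i<2 ^ b. (- 1) ^ s2 (i + 2 ^ b) * y ^ (i + 2 ^ b))"
    by (rule sum_lessThan_add)
  also have "(\<Sum>i<2 ^ b. (- 1) ^ s2 (i + 2 ^ b) * y ^ (i + 2 ^ b)) =
      (\<Sum>i<2 ^ b. - (y ^ (2 ^ b)) * ((- 1) ^ s2 i * y ^ i))"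
  proof (intro sum.cong refl)
    fix i :: nat assume "i \<in> {..<2 ^ b}"
    then have "s2 (i + 2 ^ b) = s2 i + 1" using s2_add_pow2_mult[of i b 1] by simp
    then show "(- 1) ^ s2 (i + 2 ^ b) * y ^ (i + 2 ^ b) = - (y ^ (2 ^ b)) * ((- 1) ^ s2 i * y ^ i)"
      by (simp add: power_add)
  qed
  also have "\<dots> = - (y ^ (2 ^ b)) * (\<Sum>i<2 ^ b. (- 1) ^ s2 i * y ^ i)"
    by (rule sum_distrib_left[symmetric])
  finally show ?case using Suc by (simp add: algebra_simps)
qed simp

context
  fixes a :: "nat \<Rightarrow> real" and K :: nat and \<beta> :: real
  assumes K: "K \<ge> 1" and a: "a K \<noteq> 0" and \<beta>: "\<beta> > 1"
begin

abbreviation "u \<equiv> weighted_thue_morse a K"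

text \<open>
  It suffices that a window of length at least \<open>2 * 2 ^ b - 2\<close> contributes \<open>e / \<beta> ^ (2 ^ b)\<close>
  with \<open>e\<close> bounded and not too small: the rest is \<open>O(\<beta> ^ (- 2 * 2 ^ b))\<close>.
\<close>

lemma close_pairs_of_window:
  fixes A :: nat and q :: real
  assumes q: "q > 0"
  assumes window: "\<And>b. b \<ge> 1 \<Longrightarrow> \<exists>N N' e J. N \<le> 2 ^ (A * b) \<and> N' \<le> 2 ^ (A * b) \<and>
    \<bar>a K\<bar> * q ^ b \<le> \<bar>e\<bar> \<and> \<bar>e\<bar> \<le> \<bar>a K\<bar> \<and> 2 * 2 ^ b - 2 \<le> J \<and>
    (\<Sum>n<J. (u (N + Suc n) - u (N' + Suc n)) / \<beta> ^ Suc n) = e / \<beta> ^ (2 ^ b)"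
  shows "\<exists>A M. eventually (\<lambda>b. \<exists>N N'. N \<le> 2 ^ (A * b) \<and> N' \<le> 2 ^ (A * b) \<and>
    (\<Sum>n. (u (N + Suc n) - u (N' + Suc n)) / \<beta> ^ Suc n) \<noteq> 0 \<and>
    \<bar>\<Sum>n. (u (N + Suc n) - u (N' + Suc n)) / \<beta> ^ Suc n\<bar> \<le> M / \<beta> ^ (2 ^ b)) sequentially"
proof -
  define B where "B = 2 * (\<Sum>k=1..K. \<bar>a k\<bar>)"
  \<comment> \<open>The factor \<open>\<beta> ^ 2\<close> pays for a window that may end two short
    of \<open>2 * 2 ^ b\<close>.\<close>
  define R where "R = B * \<beta> ^ 2 / (\<beta> - 1)"
  have R: "R \<ge> 0" using \<beta> by (auto simp: R_def B_def intro!: divide_nonneg_nonneg mult_nonneg_nonneg sum_nonneg)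
  \<comment> \<open>The lower bound for \<open>e\<close> decays at most exponentially in
    \<open>b\<close>, so \<open>e / \<beta> ^ (2 ^ b)\<close> eventually dominates the
    remainder.\<close>
  have "eventually (\<lambda>b. R / \<bar>a K\<bar> * (1 / q) ^ b < \<beta> ^ (2 ^ b)) sequentially"
    by (rule double_exponential_growth[OF \<beta>])
  moreover have "eventually (\<lambda>b::nat. b \<ge> 1) sequentially" by (rule eventually_ge_at_top)
  ultimately have "eventually (\<lambda>b. \<exists>N N'. N \<le> 2 ^ (A * b) \<and> N' \<le> 2 ^ (A * b) \<and>
    (\<Sum>n. (u (N + Suc n) - u (N' + Suc n)) / \<beta> ^ Suc n) \<noteq> 0 \<and>
    \<bar>\<Sum>n. (u (N + Suc n) - u (N' + Suc n)) / \<beta> ^ Suc n\<bar> \<le> (\<bar>a K\<bar> + R) / \<beta> ^ (2 ^ b)) sequentially"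
  proof eventually_elim
    case (elim b)
    from window[OF elim(2)] obtain N N' e J where
      N: "N \<le> 2 ^ (A * b)" "N' \<le> 2 ^ (A * b)" and e: "\<bar>a K\<bar> * q ^ b \<le> \<bar>e\<bar>" "\<bar>e\<bar> \<le> \<bar>a K\<bar>"
      and J: "2 * 2 ^ b - 2 \<le> J" and head: "(\<Sum>n<J. (u (N + Suc n) - u (N' + Suc n)) / \<beta> ^ Suc n) = e / \<beta> ^ (2 ^ b)"
      by blast
    define x where "x = \<beta> ^ (2 ^ b)"
    define V where "V = (\<Sum>n. (u (N + Suc n) - u (N' + Suc n)) / \<beta> ^ Suc n)"
    have x: "x \<ge> 1" using \<beta> by (simp add: x_def one_le_power)
    have B: "B \<ge> 0" by (auto simp: B_def intro!: mult_nonneg_nonneg sum_nonneg)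
    have "\<bar>V - e / x\<bar> \<le> B / (\<beta> ^ J * (\<beta> - 1))"
      using suminf_split_geometric(2)[OF \<beta> weighted_thue_morse_diff_bound, of a K "\<lambda>n. N + Suc n" "\<lambda>n. N' + Suc n" J]
      by (simp only: V_def x_def head B_def)
    also have "\<dots> \<le> B / (\<beta> ^ (2 * 2 ^ b - 2) * (\<beta> - 1))"
      using \<beta> J B by (intro divide_left_mono mult_right_mono power_increasing) auto
    also have "\<beta> ^ (2 * 2 ^ b - 2) = x ^ 2 / \<beta> ^ 2"
      using \<beta> elim(2) by (subst power_diff) (auto simp: x_def power_mult[symmetric] mult.commute)
    also have "B / (x ^ 2 / \<beta> ^ 2 * (\<beta> - 1)) = R / x ^ 2"
      by (simp add: R_def)
    finally have V: "\<bar>V - e / x\<bar> \<le> R / x ^ 2" .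
    have "R < \<bar>a K\<bar> * q ^ b * x"
      using elim(1) a q by (simp add: x_def[symmetric] field_simps)
    also have "\<dots> \<le> \<bar>e\<bar> * x" using e x by (intro mult_right_mono) auto
    finally have "R / x ^ 2 < \<bar>e / x\<bar>" using x by (simp add: field_simps power2_eq_square)
    with V have "V \<noteq> 0" by auto
    have "R / x ^ 2 \<le> R / x" using x R by (intro divide_left_mono) (auto simp: power2_eq_square)
    moreover have "\<bar>e / x\<bar> = \<bar>e\<bar> / x" using x by simp
    ultimately have "\<bar>V\<bar> \<le> \<bar>e\<bar> / x + R / x" using V by linarith
    then have "\<bar>V\<bar> \<le> (\<bar>a K\<bar> + R) / x"
      using e(2) x by (smt (verit) add_divide_distrib divide_right_mono)
    with \<open>V \<noteq> 0\<close> show ?case using N unfolding V_def x_def by blast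
  qed
  then show ?thesis by blast
qed

text \<open>For \<open>K = 1\<close> the window gives a product of \<open>b\<close> factors, each at
  least \<open>1 - 1 / \<beta>\<close>, which is the choice of \<open>q\<close>. For
  \<open>K \<ge> 2\<close> a single term survives, and \<open>q = 1\<close>.\<close>

lemma close_pairs:
  "\<exists>A M. eventually (\<lambda>b. \<exists>N N'. N \<le> 2 ^ (A * b) \<and> N' \<le> 2 ^ (A * b) \<and>
    (\<Sum>n. (u (N + Suc n) - u (N' + Suc n)) / \<beta> ^ Suc n) \<noteq> 0 \<and>
    \<bar>\<Sum>n. (u (N + Suc n) - u (N' + Suc n)) / \<beta> ^ Suc n\<bar> \<le> M / \<beta> ^ (2 ^ b)) sequentially"
proof (cases "K = 1")
  case True
  show ?thesis
  proof (rule close_pairs_of_window[of "1 - 1 / \<beta>" 2])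
    show "1 - 1 / \<beta> > 0" using \<beta> by simp
    fix b :: nat assume b: "b \<ge> 1"
    define w where "w n = (u (2 ^ b + Suc n) - u (2 ^ (b + 1) + Suc n)) / \<beta> ^ Suc n" for n
    \<comment> \<open>For \<open>j < 2 ^ b\<close>, adding \<open>2 ^ b\<close> or
      \<open>2 ^ (b + 1)\<close> to \<open>j\<close> sets one new bit, so the terms cancel.\<close>
    have w0: "w n = 0" if "Suc n < 2 ^ b" for n
    proof -
      have "s2 (Suc n + 2 ^ b * 1) = Suc (s2 (Suc n))" "s2 (Suc n + 2 ^ b * 2) = Suc (s2 (Suc n))"
        using that s2_add_pow2_mult[of "Suc n" b 1] s2_add_pow2_mult[of "Suc n" b 2] s2_pow2[of 1] by simp_all
      then show ?thesis using True
        by (simp add: w_def weighted_thue_morse_def thue_morse_def add.commute mult.commute)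
    qed
    \<comment> \<open>With \<open>j = i + 2 ^ b\<close> the arguments are
      \<open>2 * 2 ^ b + i\<close> and \<open>3 * 2 ^ b + i\<close>. Their digit sums exceed that of
      \<open>i\<close> by one and by two, so the difference of the Thue-Morse values is the sign
      \<open>(- 1) ^ s2 i\<close>.\<close>
    have w1: "w (i + (2 ^ b - 1)) = a K / \<beta> ^ (2 ^ b) * ((- 1) ^ s2 i * (1 / \<beta>) ^ i)" if "i < 2 ^ b" for i
    proof -
      have "s2 2 = 1" "s2 3 = 2" using s2_pow2[of 1] s2_Suc_double[of 1] by (simp_all add: numeral_3_eq_3)
      then have s: "s2 (i + 2 ^ b * 2) = s2 i + 1" "s2 (i + 2 ^ b * 3) = s2 i + 2"
        using s2_add_pow2_mult[OF that, of 2] s2_add_pow2_mult[OF that, of 3] by simp_all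
      have n: "Suc (i + (2 ^ b - 1)) = i + 2 ^ b" by simp
      have "2 ^ b + (i + 2 ^ b) = i + 2 ^ b * 2" "2 ^ (b + 1) + (i + 2 ^ b) = i + 2 ^ b * (3::nat)" by simp_all
      then show ?thesis
        unfolding w_def n using True
        by (simp only:) (simp add: weighted_thue_morse_def thue_morse_def s power_add power_divide)
    qed
    define P where "P = (\<Prod>l<b. 1 - (1 / \<beta>) ^ (2 ^ l))"
    have "2 * 2 ^ b - 1 = (2 ^ b - 1) + (2 ^ b :: nat)" by simp
    then have "(\<Sum>n<2 * 2 ^ b - 1. w n) = (\<Sum>n<2 ^ b - 1. w n) + (\<Sum>i<2 ^ b. w (i + (2 ^ b - 1)))"
      by (simp only: sum_lessThan_add)
    also have "(\<Sum>n<2 ^ b - 1. w n) = 0" by (intro sum.neutral ballI w0) auto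
    also have "0 + (\<Sum>i<2 ^ b. w (i + (2 ^ b - 1))) = (\<Sum>i<2 ^ b. w (i + (2 ^ b - 1)))" by simp
    also have "\<dots> = a K / \<beta> ^ (2 ^ b) * P"
      unfolding P_def thue_morse_product[symmetric] sum_distrib_left
      by (intro sum.cong refl w1) auto
    finally have head: "(\<Sum>n<2 * 2 ^ b - 1. w n) = a K * P / \<beta> ^ (2 ^ b)" by simp
    have fac: "1 - 1 / \<beta> \<le> 1 - (1 / \<beta>) ^ (2 ^ l)" "1 - (1 / \<beta>) ^ (2 ^ l) \<le> 1" for l
      using \<beta> power_decreasing[of 1 "2 ^ l" "1 / \<beta>"] by auto
    have "(1 - 1 / \<beta>) ^ b = (\<Prod>l<b. 1 - 1 / \<beta>)" by simp
    also have "\<dots> \<le> P" unfolding P_def using fac \<beta> by (intro prod_mono) auto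
    finally have P1: "(1 - 1 / \<beta>) ^ b \<le> P" .
    have "0 \<le> (1 - 1 / \<beta>) ^ b" using \<beta> by simp
    with P1 have P0: "P \<ge> 0" by linarith
    have "0 \<le> 1 - (1 / \<beta>) ^ (2 ^ l)" for l using fac(1)[of l] \<beta> by (smt (verit) divide_less_eq_1)
    then have P2: "P \<le> 1" unfolding P_def using fac by (intro prod_le_1) auto
    have "(2::nat) ^ b \<le> 2 ^ (2 * b)" "(2::nat) ^ (b + 1) \<le> 2 ^ (2 * b)"
      using b by (auto intro!: power_increasing simp del: power_Suc simp flip: power_Suc)
    moreover have "\<bar>a K\<bar> * (1 - 1 / \<beta>) ^ b \<le> \<bar>a K * P\<bar>" "\<bar>a K * P\<bar> \<le> \<bar>a K\<bar>"
      using P0 P1 P2 by (auto simp: abs_mult intro: mult_left_mono mult_left_le)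
    moreover have "2 * 2 ^ b - 2 \<le> 2 * 2 ^ b - (1::nat)" by simp
    ultimately show "\<exists>N N' e J. N \<le> 2 ^ (2 * b) \<and> N' \<le> 2 ^ (2 * b) \<and>
      \<bar>a K\<bar> * (1 - 1 / \<beta>) ^ b \<le> \<bar>e\<bar> \<and> \<bar>e\<bar> \<le> \<bar>a K\<bar> \<and> 2 * 2 ^ b - 2 \<le> J \<and>
      (\<Sum>n<J. (u (N + Suc n) - u (N' + Suc n)) / \<beta> ^ Suc n) = e / \<beta> ^ (2 ^ b)"
      using head unfolding w_def by blast
  qed
next
  case False
  then have K2: "K \<ge> 2" using K by simp
  obtain A where pairs: "\<And>b. b \<ge> 1 \<Longrightarrow> \<exists>N N'. N \<le> 2 ^ (A * b) \<and> N' \<le> 2 ^ (A * b) \<and>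
    (\<forall>j\<le>2 * 2 ^ b - 2. (\<forall>k<K. thue_morse ((N + j) ^ k) = thue_morse ((N' + j) ^ k)) \<and>
       (thue_morse ((N + j) ^ K) \<noteq> thue_morse ((N' + j) ^ K) \<longleftrightarrow> j = 2 ^ b))"
    using separating_pairs[OF K2] by blast
  show ?thesis
  proof (rule close_pairs_of_window[of 1 A])
    fix b :: nat assume b: "b \<ge> 1"
    from pairs[OF b] obtain N N' where N: "N \<le> 2 ^ (A * b)" "N' \<le> 2 ^ (A * b)" and
      below: "\<And>j k. j \<le> 2 * 2 ^ b - 2 \<Longrightarrow> k < K \<Longrightarrow> thue_morse ((N + j) ^ k) = thue_morse ((N' + j) ^ k)" and
      top: "\<And>j. j \<le> 2 * 2 ^ b - 2 \<Longrightarrow> thue_morse ((N + j) ^ K) \<noteq> thue_morse ((N' + j) ^ K) \<longleftrightarrow> j = 2 ^ b"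
      by blast
    define s where "s j = real (thue_morse ((N + j) ^ K)) - real (thue_morse ((N' + j) ^ K))" for j
    have diff: "u (N + j) - u (N' + j) = a K * s j" if "j \<le> 2 * 2 ^ b - 2" for j
    proof -
      have "{1..K} = insert K {1..<K}" using K by auto
      then show ?thesis using below[OF that] by (simp add: weighted_thue_morse_def s_def algebra_simps)
    qed
    have s0: "s j = 0" if "j \<le> 2 * 2 ^ b - 2" "j \<noteq> 2 ^ b" for j
      using top[OF that(1)] that(2) by (simp add: s_def)
    have two: "(2::nat) \<le> 2 ^ b" using b by (metis one_le_numeral power_increasing power_one_right)
    have s1: "\<bar>s (2 ^ b)\<bar> = 1"
    proof -
      have "2 ^ b \<le> 2 * 2 ^ b - (2::nat)" using two by linarith
      from top[OF this] show ?thesis by (auto simp: s_def thue_morse_def split: if_splits)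
    qed
    have "(\<Sum>n<2 * 2 ^ b - 2. (u (N + Suc n) - u (N' + Suc n)) / \<beta> ^ Suc n) =
        (\<Sum>n\<in>{2 ^ b - 1}. a K * s (Suc n) / \<beta> ^ Suc n)"
    proof (rule sum.mono_neutral_cong_right)
      show "{2 ^ b - 1} \<subseteq> {..<2 * 2 ^ b - (2::nat)}" using two by auto
      show "\<forall>i\<in>{..<2 * 2 ^ b - 2} - {2 ^ b - 1}. (u (N + Suc i) - u (N' + Suc i)) / \<beta> ^ Suc i = 0"
      proof
        fix i assume "i \<in> {..<2 * 2 ^ b - 2} - {2 ^ b - (1::nat)}"
        then have "Suc i \<le> 2 * 2 ^ b - 2" "Suc i \<noteq> 2 ^ b" using two by auto
        then show "(u (N + Suc i) - u (N' + Suc i)) / \<beta> ^ Suc i = 0" using diff[of "Suc i"] s0[of "Suc i"] by simp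
      qed
    qed (use two in \<open>auto simp del: power_Suc add_Suc_right simp: diff\<close>)
    also have "\<dots> = a K * s (2 ^ b) / \<beta> ^ (2 ^ b)" by simp
    finally show "\<exists>N N' e J. N \<le> 2 ^ (A * b) \<and> N' \<le> 2 ^ (A * b) \<and>
      \<bar>a K\<bar> * 1 ^ b \<le> \<bar>e\<bar> \<and> \<bar>e\<bar> \<le> \<bar>a K\<bar> \<and> 2 * 2 ^ b - 2 \<le> J \<and>
      (\<Sum>n<J. (u (N + Suc n) - u (N' + Suc n)) / \<beta> ^ Suc n) = e / \<beta> ^ (2 ^ b)"
      using N s1
      by (intro exI[of _ N] exI[of _ N'] exI[of _ "a K * s (2 ^ b)"] exI[of _ "2 * 2 ^ b - 2"]) (auto simp: abs_mult)
  qed simp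
qed

end

subsection \<open>Linear independence\<close>

text \<open>A relation yields tails whose nonzero differences are at least inverse polynomial in the
  positions. The close pairs have positions exponential in \<open>b\<close> and differences doubly
  exponentially small.\<close>

lemma linear_independence:
  fixes \<beta> :: real
  assumes alg: "algebraic_int \<beta>" and \<beta>: "\<beta> > 1"
    and conj: "\<And>z. z \<in> galois_conjugates \<beta> - {of_real \<beta>} \<Longrightarrow> norm z \<le> 1"
  shows "lin_indep_family (rat_adjoin \<beta>) (thue_morse_family \<beta>)"
  unfolding lin_indep_family_def
proof (intro allI impI, rule ccontr)
  fix I :: "nat set" and c :: "nat \<Rightarrow> real"
  assume *: "finite I \<and> (\<forall>i\<in>I. c i \<in> rat_adjoin \<beta>) \<and> (\<Sum>i\<in>I. c i * thue_morse_family \<beta> i) = 0"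
    and "\<not> (\<forall>i\<in>I. c i = 0)"
  then have fin: "finite I" and dep: "(\<Sum>i\<in>I. c i * thue_morse_family \<beta> i) = 0"
    and nz: "\<exists>i\<in>I. c i \<noteq> 0" by auto
  obtain A0 :: "nat \<Rightarrow> int poly" and R :: "int poly" where R: "poly (of_int_poly R) \<beta> \<noteq> 0"
    and A0: "\<And>i. i \<in> I \<Longrightarrow> c i * poly (of_int_poly R) \<beta> = poly (of_int_poly (A0 i)) \<beta>"
    using rat_adjoin_common_denominator[of I c \<beta>] * by blast
  \<comment> \<open>Zero outside \<open>I\<close>, so that the relation can be summed over all
    indices up to \<open>K\<close>.\<close>
  define A where "A i = (if i \<in> I then A0 i else 0)" for i
  define a where "a i = poly (of_int_poly (A i)) \<beta>" for i
  have a: "a i = c i * poly (of_int_poly R) \<beta>" if "i \<in> I" for i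
    using A0[OF that] that by (simp add: a_def A_def)
  have a0: "a i = 0" if "i \<notin> I" for i using that by (simp add: a_def A_def)
  define S where "S = {i \<in> I. a i \<noteq> 0}"
  have S: "finite S" "S \<noteq> {}" using fin nz R by (auto simp: S_def a)
  define K where "K = Max S"
  have "K \<in> S" unfolding K_def using S by (rule Max_in)
  then have aK: "a K \<noteq> 0" by (simp add: S_def)
  have "(\<Sum>i\<in>I. a i * thue_morse_family \<beta> i) = poly (of_int_poly R) \<beta> * (\<Sum>i\<in>I. c i * thue_morse_family \<beta> i)"
    unfolding sum_distrib_left by (intro sum.cong) (auto simp: a)
  also have "\<dots> = 0" using dep by simp
  finally have "(\<Sum>i\<in>I. a i * thue_morse_family \<beta> i) = 0" .
  also have "(\<Sum>i\<in>I. a i * thue_morse_family \<beta> i) = (\<Sum>i\<in>S. a i * thue_morse_family \<beta> i)"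
    using fin by (intro sum.mono_neutral_right) (auto simp: S_def)
  also have "\<dots> = (\<Sum>i\<le>K. a i * thue_morse_family \<beta> i)"
  proof (rule sum.mono_neutral_left)
    show "S \<subseteq> {..K}" using Max_ge[OF S(1)] by (auto simp: K_def)
    show "\<forall>i\<in>{..K} - S. a i * thue_morse_family \<beta> i = 0" using a0 by (auto simp: S_def)
  qed simp
  also have "{..K} = insert 0 {1..K}" by auto
  finally have rel: "a 0 + (\<Sum>k=1..K. a k * thue_morse_value \<beta> k) = 0"
    by (simp add: thue_morse_family_def)
  \<comment> \<open>For \<open>K = 0\<close> the relation would say \<open>a 0 = 0\<close>.\<close>
  with aK have K: "K \<ge> 1" by (cases K) auto
  define U where "U n = (\<Sum>k=1..K. Polynomial.smult (int (thue_morse (n ^ k))) (A k))" for n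
  have U_eval: "poly (of_int_poly (U n)) \<beta> = weighted_thue_morse a K n" for n
    by (simp add: U_def weighted_thue_morse_def a_def of_int_poly_hom.hom_sum
      of_int_hom.map_poly_hom_smult poly_sum mult.commute)
  \<comment> \<open>\<open>U n\<close> depends only on \<open>K\<close> values in
    \<open>{0, 1}\<close>.\<close>
  have finU: "finite (range U)"
  proof (rule finite_subset)
    show "range U \<subseteq> (\<lambda>f. \<Sum>k=1..K. Polynomial.smult (f k) (A k)) ` ({1..K} \<rightarrow>\<^sub>E {0, 1})"
    proof
      fix q assume "q \<in> range U"
      then obtain n where n: "q = U n" by blast
      show "q \<in> (\<lambda>f. \<Sum>k=1..K. Polynomial.smult (f k) (A k)) ` ({1..K} \<rightarrow>\<^sub>E {0, 1})"
        by (rule image_eqI[of _ _ "\<lambda>k\<in>{1..K}. int (thue_morse (n ^ k))"])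
          (auto simp: n U_def thue_morse_def)
    qed
  qed (intro finite_imageI finite_PiE, auto)
  have sm: "summable (\<lambda>n. real (thue_morse (Suc n ^ k)) / \<beta> ^ Suc n)" for k
    by (rule suminf_split_geometric[OF \<beta>, of _ 1]) (simp add: thue_morse_def)
  have "(\<Sum>k=1..K. a k * thue_morse_value \<beta> k) =
      (\<Sum>k=1..K. \<Sum>n. a k * (real (thue_morse (Suc n ^ k)) / \<beta> ^ Suc n))"
    unfolding thue_morse_value_def by (simp only: suminf_mult[OF sm])
  also have "\<dots> = (\<Sum>n. \<Sum>k=1..K. a k * (real (thue_morse (Suc n ^ k)) / \<beta> ^ Suc n))"
    by (rule suminf_sum[symmetric]) (rule summable_mult[OF sm])
  also have "\<dots> = (\<Sum>n. weighted_thue_morse a K (Suc n) / \<beta> ^ Suc n)"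
    by (simp only: weighted_thue_morse_def sum_divide_distrib times_divide_eq_right)
  finally have "poly (of_int_poly (A 0)) \<beta> + (\<Sum>n. poly (of_int_poly (U (Suc n))) \<beta> / \<beta> ^ Suc n) = 0"
    using rel by (simp only: U_eval a_def)
  from tail_difference_lower_bound[OF alg \<beta> conj finU this, unfolded U_eval]
  obtain C D where C: "C > 0" and lower: "\<And>N N' M. N \<le> M \<Longrightarrow> N' \<le> M \<Longrightarrow>
      (\<Sum>n. (weighted_thue_morse a K (N + Suc n) - weighted_thue_morse a K (N' + Suc n)) / \<beta> ^ Suc n) \<noteq> 0 \<Longrightarrow>
      1 \<le> \<bar>\<Sum>n. (weighted_thue_morse a K (N + Suc n) - weighted_thue_morse a K (N' + Suc n)) / \<beta> ^ Suc n\<bar> *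
        (C * (real M + 1) ^ D)"
    by blast
  obtain e M where close: "eventually (\<lambda>b. \<exists>N N'. N \<le> 2 ^ (e * b) \<and> N' \<le> 2 ^ (e * b) \<and>
      (\<Sum>n. (weighted_thue_morse a K (N + Suc n) - weighted_thue_morse a K (N' + Suc n)) / \<beta> ^ Suc n) \<noteq> 0 \<and>
      \<bar>\<Sum>n. (weighted_thue_morse a K (N + Suc n) - weighted_thue_morse a K (N' + Suc n)) / \<beta> ^ Suc n\<bar>
        \<le> M / \<beta> ^ (2 ^ b)) sequentially"
    using close_pairs[of K a \<beta>, OF K aK \<beta>] by blast
  \<comment> \<open>The left side is the polynomial bound at positions up to
    \<open>2 ^ (e * b)\<close>, where \<open>2 ^ (e * b) + 1 \<le> 2 * 2 ^ (e * b)\<close>,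
    multiplied by \<open>M\<close>.\<close>
  have "eventually (\<lambda>b. M * C * 2 ^ D * (2 ^ (e * D)) ^ b < \<beta> ^ (2 ^ b)) sequentially"
    by (rule double_exponential_growth[OF \<beta>])
  with close have "eventually (\<lambda>b. False) sequentially"
  proof eventually_elim
    case (elim b)
    obtain N N' V where N: "N \<le> 2 ^ (e * b)" "N' \<le> 2 ^ (e * b)" and V: "V \<noteq> 0" "\<bar>V\<bar> \<le> M / \<beta> ^ (2 ^ b)"
      and V_def: "V = (\<Sum>n. (weighted_thue_morse a K (N + Suc n) - weighted_thue_morse a K (N' + Suc n)) / \<beta> ^ Suc n)"
      using elim(1) by blast
    have "1 \<le> \<bar>V\<bar> * (C * (real (2 ^ (e * b)) + 1) ^ D)"
      using lower[OF N] V(1) unfolding V_def by blast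
    also have "\<dots> \<le> M / \<beta> ^ (2 ^ b) * (C * (2 * 2 ^ (e * b)) ^ D)"
      using C V(2) by (intro mult_mono mult_left_mono power_mono order_trans[OF abs_ge_zero V(2)]) auto
    also have "\<dots> = M * C * 2 ^ D * (2 ^ (e * D)) ^ b / \<beta> ^ (2 ^ b)"
      by (simp add: power_mult_distrib power_mult[symmetric] mult_ac)
    finally show False using elim(2) \<beta> by (simp add: field_simps)
  qed
  then show False by simp
qed

theorem theorem1p1:
  shows "(\<forall>\<beta>::real. (pisot \<beta> \<or> salem \<beta>) \<and> \<beta> > sqrt ((1 + sqrt 5) / 2) \<longrightarrow>
            lin_indep_family (rat_adjoin \<beta>) (thue_morse_family \<beta>)) \<and>
         (\<forall>\<beta>::real. pisot \<beta> \<longrightarrow> lin_indep_family (rat_adjoin \<beta>) (thue_morse_family \<beta>))"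
proof -
  have "lin_indep_family (rat_adjoin \<beta>) (thue_morse_family \<beta>)" if "pisot \<beta> \<or> salem \<beta>" for \<beta>
    using that by (intro linear_independence) (auto simp: pisot_def salem_def intro: less_imp_le)
  then show ?thesis by blast
qed

end
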